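(* $J(P)$ is an $S_0$-homotopy invariant of nanophrases $P$ over $\alpha_0=\{a,b\}$: if $P\simeq_{S_0}P'$ for nanophrases $P,P'$ over $\alpha_0$, where $S_0=\{(a,a,a),(b,b,b)\}$ and $\tau_0:a\leftrightarrow b$, then $J(P)=J(P')$.
   Context: **Nanophrases.** An $\alpha$-alphabet is a finite set $\mathcal{A}$ with a projection $\mathcal{A}\to\alpha$, $A\mapsto|A|$. A nanophrase of length $k\ge1$ over $\alpha$ is a pair $(\mathcal{A},P)$ with $\mathcal{A}$ an $\alpha$-alphabet and $P=w_1|\cdots|w_k$ a sequence of $k$ (possibly empty) words in $\mathcal{A}$ such that every letter of $\mathcal{A}$ occurs exactly twice in $w_1\cdots w_k$. Isomorphism: a projection-preserving bijection of alphabets carrying components to corresponding components. **$S_0$-homotopy.** $\simeq_{S_0}$ is the equivalence relation on nanophrases over $\alpha_0$ generated by isomorphisms and the moves (with $x,y,z,t$ words in the remaining letters, possibly containing the separator $|$): (H1) $(\mathcal{A},xAAy)\to(\mathcal{A}\setminus\{A\},xy)$; (H2) $(\mathcal{A},xAByBAz)\to(\mathcal{A}\setminus\{A,B\},xyz)$ if $\tau_0(|A|)=|B|$; (H3) $(\mathcal{A},xAByACzBCt)\to(\mathcal{A},xBAyCAzCBt)$ if $(|A|,|B|,|C|)\in S_0$. **The Jones polynomial $J$.** A nanophrase over $\alpha_0$ is regarded as a nanophrase over $\alpha_1=\{1,-1\}$ via $a\mapsto1$, $b\mapsto-1$. For a nanophrase $(\mathcal{A},P)$ over $\alpha_1$: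 - For a word $w$, $w^-$ is the word in the opposite order, and $Q_w$ denotes the phrase $Q$ with $|A|$ replaced by $-|A|$ for each letter $A$ occurring exactly once in $w$. - A state is a map $s=\mathrm{mark}:\mathcal{A}\to\{-1,1\}$. Phrases over $\alpha_1$ with a state are considered up to cyclic shifts of components (projections unchanged), permutations of components (projections unchanged), and inversions of a component (replace $w_i$ by $w_i^-$ and $|A|$ by $-|A|$ for each letter occurring exactly once in $w_i$); markers are unchanged. Using these, a letter $A$ is deleted by $w_1|\cdots|AxAy|\cdots|w_k\to w_1|\cdots|x|y|\cdots|w_k$ if $\mathrm{mark}(A)=|A|$, and $\to(w_1|\cdots|x^-y|\cdots|w_k)_x$ if $\mathrm{mark}(A)=-|A|$; $w_1|\cdots|Ax|Ay|\cdots|w_k\to w_1|\cdots|xy|\cdots|w_k$ if $\mathrm{mark}(A)=|A|$, and $\to(w_1|\cdots|x^-y|\cdots|w_k)_x$ if $\mathrm{mark}(A)=-|A|$. Deleting all letters gives $\emptyset|\cdots|\emptyset$, whose number of components is $|s|$ (independent of the order of deletion). - $\sigma(s)=\#\{A:\mathrm{mark}(A)=1\}-\#\{A:\mathrm{mark}(A)=-1\}$, $w(P)=\sum_{A\in\mathcal{A}}|A|$, and $$J(P)=(-t)^{-3w(P)}\sum_{s}t^{\sigma(s)}(-t^2-t^{-2})^{|s|-1}\in\mathbb{Z}[t,t^{-1}].$$ *)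

theory Defs
  imports "HOL-Library.FuncSet" "HOL-Library.Multiset" "HOL-Library.Poly_Mapping"
begin

section \<open>Nanophrases\<close>

text \<open>
  Only the restriction of \<open>proj\<close> to \<open>alphabet\<close> is meaningful; the other values of \<open>proj\<close> are
  arbitrary and are ignored by isomorphisms.
\<close>

record ('l, 'p) nanophrase =
  alphabet :: "'l set"
  proj :: "'l \<Rightarrow> 'p"
  phrase :: "'l list list"

definition is_nanophrase :: "('l, 'p) nanophrase \<Rightarrow> bool" where
  "is_nanophrase N \<longleftrightarrow>
     finite (alphabet N) \<and>
     phrase N \<noteq> [] \<and>
     (\<forall>w \<in> set (phrase N). set w \<subseteq> alphabet N) \<and>
     (\<forall>A \<in> alphabet N. count_list (concat (phrase N)) A = 2)"

definition isomorphic :: "('l, 'p) nanophrase \<Rightarrow> ('l, 'p) nanophrase \<Rightarrow> bool" where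
  "isomorphic N N' \<longleftrightarrow>
     (\<exists>f. bij_betw f (alphabet N) (alphabet N') \<and>
          (\<forall>A \<in> alphabet N. proj N' (f A) = proj N A) \<and>
          phrase N' = map (map f) (phrase N))"

section \<open>Homotopy\<close>

text \<open>
  For the moves, a phrase is written as one word over letters (\<open>Some A\<close>) and the separator
  (\<open>None\<close>); \<open>components\<close> cuts such a word at its separators. It is a bijection onto the nonempty
  lists of words.
\<close>

fun components :: "'l option list \<Rightarrow> 'l list list" where
  "components [] = [[]]"
| "components (None # u) = [] # components u"
| "components (Some A # u) = (A # hd (components u)) # tl (components u)"

text \<open>
  The letters written with different names are distinct and do not occur in \<open>x\<close>, \<open>y\<close>, \<open>z\<close>, \<open>t\<close>:
  \<open>homotopy_step\<close> below only relates nanophrases, in which every letter occurs exactly twice.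
\<close>

inductive homotopy_move ::
  "('p \<Rightarrow> 'p) \<Rightarrow> ('p \<times> 'p \<times> 'p) set \<Rightarrow> ('l, 'p) nanophrase \<Rightarrow> ('l, 'p) nanophrase \<Rightarrow> bool"
  for \<tau> S where
  H1: "homotopy_move \<tau> S
         \<lparr>alphabet = X, proj = p, phrase = components (x @ [Some A, Some A] @ y)\<rparr>
         \<lparr>alphabet = X - {A}, proj = p, phrase = components (x @ y)\<rparr>"
| H2: "\<tau> (p A) = p B \<Longrightarrow>
       homotopy_move \<tau> S
         \<lparr>alphabet = X, proj = p,
          phrase = components (x @ [Some A, Some B] @ y @ [Some B, Some A] @ z)\<rparr>
         \<lparr>alphabet = X - {A, B}, proj = p, phrase = components (x @ y @ z)\<rparr>"
| H3: "(p A, p B, p C) \<in> S \<Longrightarrow>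
       homotopy_move \<tau> S
         \<lparr>alphabet = X, proj = p,
          phrase = components
            (x @ [Some A, Some B] @ y @ [Some A, Some C] @ z @ [Some B, Some C] @ t)\<rparr>
         \<lparr>alphabet = X, proj = p,
          phrase = components
            (x @ [Some B, Some A] @ y @ [Some C, Some A] @ z @ [Some C, Some B] @ t)\<rparr>"

definition homotopy_step ::
  "('p \<Rightarrow> 'p) \<Rightarrow> ('p \<times> 'p \<times> 'p) set \<Rightarrow> ('l, 'p) nanophrase \<Rightarrow> ('l, 'p) nanophrase \<Rightarrow> bool" where
  "homotopy_step \<tau> S N N' \<longleftrightarrow>
     is_nanophrase N \<and> is_nanophrase N' \<and> (isomorphic N N' \<or> homotopy_move \<tau> S N N')"

definition homotopic ::
  "('p \<Rightarrow> 'p) \<Rightarrow> ('p \<times> 'p \<times> 'p) set \<Rightarrow> ('l, 'p) nanophrase \<Rightarrow> ('l, 'p) nanophrase \<Rightarrow> bool" where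
  "homotopic \<tau> S = equivclp (homotopy_step \<tau> S)"

datatype alpha0 = a0 | b0

fun tau0 :: "alpha0 \<Rightarrow> alpha0" where
  "tau0 a0 = b0"
| "tau0 b0 = a0"

definition S0 :: "(alpha0 \<times> alpha0 \<times> alpha0) set" where
  "S0 = {(a0, a0, a0), (b0, b0, b0)}"

section \<open>States and their resolution\<close>

definition negate_once :: "'l list \<Rightarrow> ('l \<Rightarrow> int) \<Rightarrow> 'l \<Rightarrow> int" where
  "negate_once w p = (\<lambda>A. if count_list w A = 1 then - p A else p A)"

text \<open>
  The phrases below carry projections to \<open>{1, -1}\<close> as integers. A pair \<open>(p, P)\<close> is a phrase together
  with its current projection, and \<open>mark\<close> is the state. The first three rules generate the equivalence
  up to which phrases with a state are considered (each is undone by a rule of the same kind).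
\<close>

inductive resolve_step ::
  "('l \<Rightarrow> int) \<Rightarrow> ('l \<Rightarrow> int) \<times> 'l list list \<Rightarrow> ('l \<Rightarrow> int) \<times> 'l list list \<Rightarrow> bool"
  for mark where
  shift: "resolve_step mark (p, us @ [x @ y] @ vs) (p, us @ [y @ x] @ vs)"
| permute: "mset P = mset P' \<Longrightarrow> resolve_step mark (p, P) (p, P')"
| invert: "resolve_step mark (p, us @ [w] @ vs) (negate_once w p, us @ [rev w] @ vs)"
| split_pos: "mark A = p A \<Longrightarrow>
    resolve_step mark (p, us @ [[A] @ x @ [A] @ y] @ vs) (p, us @ [x, y] @ vs)"
| split_neg: "mark A = - p A \<Longrightarrow>
    resolve_step mark (p, us @ [[A] @ x @ [A] @ y] @ vs) (negate_once x p, us @ [rev x @ y] @ vs)"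
| merge_pos: "mark A = p A \<Longrightarrow>
    resolve_step mark (p, us @ [[A] @ x, [A] @ y] @ vs) (p, us @ [x @ y] @ vs)"
| merge_neg: "mark A = - p A \<Longrightarrow>
    resolve_step mark (p, us @ [[A] @ x, [A] @ y] @ vs) (negate_once x p, us @ [rev x @ y] @ vs)"

definition state_components :: "('l, int) nanophrase \<Rightarrow> ('l \<Rightarrow> int) \<Rightarrow> nat" where
  "state_components N mark =
     (THE n. \<exists>p. (resolve_step mark)\<^sup>*\<^sup>* (proj N, phrase N) (p, replicate n []))"

section \<open>The Jones polynomial\<close>

text \<open>
  The ring of Laurent polynomials over the integers is the group ring of the additive group of
  integers: finitely supported functions from exponents to coefficients, with convolution.
\<close>

type_synonym laurent = "int \<Rightarrow>\<^sub>0 int"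

definition t_pow :: "int \<Rightarrow> laurent" where
  "t_pow n = Poly_Mapping.single n 1"

definition neg_t_pow :: "int \<Rightarrow> laurent" where
  "neg_t_pow n = (if 0 \<le> n then (- t_pow 1) ^ nat n else (- t_pow (-1)) ^ nat (- n))"

definition states :: "('l, int) nanophrase \<Rightarrow> ('l \<Rightarrow> int) set" where
  "states N = alphabet N \<rightarrow>\<^sub>E {-1, 1}"

definition state_sign :: "('l, int) nanophrase \<Rightarrow> ('l \<Rightarrow> int) \<Rightarrow> int" where
  "state_sign N mark =
     int (card {A \<in> alphabet N. mark A = 1}) - int (card {A \<in> alphabet N. mark A = -1})"

definition writhe :: "('l, int) nanophrase \<Rightarrow> int" where
  "writhe N = (\<Sum>A \<in> alphabet N. proj N A)"

definition jones1 :: "('l, int) nanophrase \<Rightarrow> laurent" where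
  "jones1 N =
     neg_t_pow (-3 * writhe N) *
     (\<Sum>s \<in> states N.
        t_pow (state_sign N s) * (- t_pow 2 - t_pow (-2)) ^ (state_components N s - 1))"

fun sign0 :: "alpha0 \<Rightarrow> int" where
  "sign0 a0 = 1"
| "sign0 b0 = -1"

definition jones :: "('l, alpha0) nanophrase \<Rightarrow> laurent" where
  "jones N = jones1 \<lparr>alphabet = alphabet N, proj = sign0 \<circ> proj N, phrase = phrase N\<rparr>"

end

theory Submission
  imports Defs
begin

text \<open>
  The polynomial is a Kauffman state sum normalized by the writhe, and its invariance is the usual one:
  the first move multiplies the state sum by \<open>- t\<^sup>3\<^sup>e\<close>, where \<open>e\<close> is the sign of the letter, which the
  writhe factor undoes; the second and third move preserve both the state sum and the writhe
  (\<open>bracket_kink\<close>, \<open>bracket_bigon\<close>, \<open>bracket_triangle\<close>). The reason is that the states of the letters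
  of a move, seen from the rest of the phrase, satisfy the relations of the Temperley-Lieb algebra with
  loop value \<open>- t\<^sup>2 - t\<^sup>-\<^sup>2\<close>.

  The work lies in the number of circles of a state. It is defined by deleting letters in any order, so
  one has to see that it is well defined; and one has to compare it before and after a move whose places
  are scattered over the components of the phrase. Both follow from counting colorings. A state leaves two
  strands at every letter, and a coloring gives one of two colors to each strand such that adjacent
  strands have the same color. It is a free choice of a color for every circle, so that a state with \<open>n\<close>
  circles has \<open>2 ^ n\<close> colorings. To say which strands are adjacent, each occurrence of a letter gets a
  tag that tells in which direction it traverses the two strands of the letter; the tags of the two
  occurrences differ if and only if the marker of the letter equals its sign.

  The number of colorings is unchanged by every step of a resolution (\<open>resolve_step_colorings\<close>), because
  summing over the colors of a letter reconnects the paths through it as the deletion of the letter does.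
  As a resolution always exists, the number of colorings is \<open>2 ^ n\<close> for the number \<open>n\<close> of circles
  (\<open>state_components_colorings\<close>).

  The number of colorings is also a contraction of tensors along the phrase. So an identity between the
  tensors of the places where two phrases differ implies the same identity between their numbers of
  colorings, wherever the places are (\<open>trace_replace\<close>). For the three moves the tensors depend on at most
  six colors and are compared by inspection (\<open>colorings_kink\<close>, \<open>bigon_eqs\<close>, \<open>triangle_eqs\<close>).
\<close>

section \<open>Colorings of phrases of directed passages\<close>

lemma sum_PiE_insert:
  assumes "A \<notin> L"
  shows "(\<Sum>f \<in> insert A L \<rightarrow>\<^sub>E S. g f) = (\<Sum>f \<in> L \<rightarrow>\<^sub>E S. \<Sum>v \<in> S. g (f(A := v)))"
proof -
  have "(\<Sum>f \<in> insert A L \<rightarrow>\<^sub>E S. g f) = (\<Sum>(v, f) \<in> S \<times> (L \<rightarrow>\<^sub>E S). g (f(A := v)))"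
    unfolding PiE_insert_eq
    by (subst sum.reindex) (use inj_combinator[OF assms, of "\<lambda>_. S"] in \<open>auto simp: case_prod_beta\<close>)
  also have "\<dots> = (\<Sum>f \<in> L \<rightarrow>\<^sub>E S. \<Sum>v \<in> S. g (f(A := v)))"
    unfolding sum.cartesian_product[symmetric] by (rule sum.swap)
  finally show ?thesis .
qed

lemma sum_PiE_image:
  assumes "inj_on h L"
  shows "(\<Sum>g \<in> h ` L \<rightarrow>\<^sub>E S. F (restrict (g \<circ> h) L)) = (\<Sum>f \<in> L \<rightarrow>\<^sub>E S. F f)"
proof (rule sum.reindex_bij_witness
    [where i = "\<lambda>f. restrict (f \<circ> inv_into L h) (h ` L)" and j = "\<lambda>g. restrict (g \<circ> h) L"])
  fix f assume f: "f \<in> L \<rightarrow>\<^sub>E S"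
  show "restrict (restrict (f \<circ> inv_into L h) (h ` L) \<circ> h) L = f"
  proof
    show "restrict (restrict (f \<circ> inv_into L h) (h ` L) \<circ> h) L A = f A" for A
      using assms by (cases "A \<in> L") (simp_all add: PiE_arb[OF f])
  qed
  show "restrict (f \<circ> inv_into L h) (h ` L) \<in> h ` L \<rightarrow>\<^sub>E S"
    using f assms by (simp add: Pi_iff PiE_def)
next
  fix g assume g: "g \<in> h ` L \<rightarrow>\<^sub>E S"
  show "restrict (restrict (g \<circ> h) L \<circ> inv_into L h) (h ` L) = g"
  proof
    show "restrict (restrict (g \<circ> h) L \<circ> inv_into L h) (h ` L) B = g B" for B
      using assms by (cases "B \<in> h ` L") (auto simp: PiE_arb[OF g])
  qed
  show "restrict (g \<circ> h) L \<in> L \<rightarrow>\<^sub>E S"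
    using g by (simp add: Pi_iff PiE_def)
qed (rule refl)

text \<open>
  A state joins the four ends of edges at a letter \<open>A\<close> in pairs, which leaves two strands at \<open>A\<close>. A
  coloring \<open>f\<close> gives them the colors \<open>fst (f A)\<close> and \<open>snd (f A)\<close>. The passage \<open>(A, True)\<close> arrives at
  the first strand and departs from the second, \<open>(A, False)\<close> the other way round. Two passages with
  different tags therefore join an arriving end to a departing one, which is the orientation preserving
  smoothing, and two passages with equal tags join the arriving ends to each other.
\<close>

type_synonym 'l passage = "'l \<times> bool"

fun enter :: "('l \<Rightarrow> bool \<times> bool) \<Rightarrow> 'l passage \<Rightarrow> bool" where
  "enter f (A, i) = (if i then fst (f A) else snd (f A))"

definition flip :: "'l passage \<Rightarrow> 'l passage" where
  "flip x = (fst x, \<not> snd x)"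

definition leave :: "('l \<Rightarrow> bool \<times> bool) \<Rightarrow> 'l passage \<Rightarrow> bool" where
  "leave f x = enter f (flip x)"

text \<open>
  An edge belongs to one circle and has one color, so the color in which \<open>w\<close> leaves a passage has to
  be the one in which it arrives at the next; \<open>walk f a w b\<close> is \<open>1\<close> if this holds along \<open>w\<close>, from
  color \<open>a\<close> to color \<open>b\<close>, and \<open>0\<close> otherwise. The numeric form makes it the entry of a product of
  matrices.
\<close>

fun walk :: "('l \<Rightarrow> bool \<times> bool) \<Rightarrow> bool \<Rightarrow> 'l passage list \<Rightarrow> bool \<Rightarrow> nat" where
  "walk f a [] b = of_bool (a = b)"
| "walk f a (x # w) b = of_bool (a = enter f x) * walk f (leave f x) w b"

text \<open>
  The trace of the matrix of \<open>w\<close>: \<open>1\<close> or \<open>0\<close> for a nonempty component according to whether \<open>f\<close> closes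
  up along it, and \<open>2\<close> for an empty one, which is a circle without letters and takes either color.
\<close>

definition closures :: "('l \<Rightarrow> bool \<times> bool) \<Rightarrow> 'l passage list \<Rightarrow> nat" where
  "closures f w = (\<Sum>a \<in> UNIV. walk f a w a)"

definition closures_phrase :: "('l \<Rightarrow> bool \<times> bool) \<Rightarrow> 'l passage list list \<Rightarrow> nat" where
  "closures_phrase f Q = (\<Prod>w\<leftarrow>Q. closures f w)"

definition letters :: "'l passage list list \<Rightarrow> 'l set" where
  "letters Q = fst ` set (concat Q)"

lemma letters_simps [simp]:
  "letters [] = {}"
  "letters (w # Q) = fst ` set w \<union> letters Q"
  "letters (Q @ Q') = letters Q \<union> letters Q'"
  by (auto simp: letters_def)

definition colorings :: "'l passage list list \<Rightarrow> nat" where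
  "colorings Q = (\<Sum>f \<in> letters Q \<rightarrow>\<^sub>E UNIV. closures_phrase f Q)"

definition reverse :: "'l passage list \<Rightarrow> 'l passage list" where
  "reverse w = rev (map flip w)"

lemma flip_flip [simp]: "flip (flip x) = x"
  by (simp add: flip_def)

lemma fst_flip [simp]: "fst (flip x) = fst x"
  by (simp add: flip_def)

lemma enter_flip [simp]: "enter f (flip x) = leave f x"
  by (simp add: leave_def)

lemma leave_flip [simp]: "leave f (flip x) = enter f x"
  by (simp add: leave_def)

lemma leave_Pair [simp]: "leave f (A, i) = (if i then snd (f A) else fst (f A))"
  by (simp add: leave_def flip_def)

lemma enter_cong: "f (fst x) = g (fst x) \<Longrightarrow> enter f x = enter g x"
  by (cases x) auto

lemma leave_cong: "f (fst x) = g (fst x) \<Longrightarrow> leave f x = leave g x"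
  by (cases x) auto

lemma walk_cong: "(\<And>A. A \<in> fst ` set w \<Longrightarrow> f A = g A) \<Longrightarrow> walk f a w b = walk g a w b"
  by (induction w arbitrary: a) (auto simp: enter_cong[of f _ g] leave_cong[of f _ g])

lemma closures_cong: "(\<And>A. A \<in> fst ` set w \<Longrightarrow> f A = g A) \<Longrightarrow> closures f w = closures g w"
  unfolding closures_def by (intro sum.cong refl walk_cong) auto

lemma closures_phrase_cong:
  "(\<And>A. A \<in> letters Q \<Longrightarrow> f A = g A) \<Longrightarrow> closures_phrase f Q = closures_phrase g Q"
  unfolding closures_phrase_def letters_def
  by (intro arg_cong[of _ _ prod_list] map_cong refl closures_cong) auto

lemma closures_phrase_simps [simp]:
  "closures_phrase f [] = 1"
  "closures_phrase f (w # Q) = closures f w * closures_phrase f Q"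
  "closures_phrase f (Q @ Q') = closures_phrase f Q * closures_phrase f Q'"
  by (simp_all add: closures_phrase_def)

lemma walk_append: "walk f a (u @ v) b = (\<Sum>c \<in> UNIV. walk f a u c * walk f c v b)"
proof (induction u arbitrary: a)
  case Nil
  show ?case by (cases a) (simp_all add: UNIV_bool)
qed (simp add: sum_distrib_left mult.assoc)

lemma walk_through:
  "walk f a (u @ x # v) b = walk f a u (enter f x) * walk f (leave f x) v b"
  by (cases "enter f x") (simp_all add: walk_append UNIV_bool)

lemma walk_reverse: "walk f a (reverse w) b = walk f b w a"
  by (induction w arbitrary: a b) (auto simp: reverse_def walk_through)

lemma closures_shift: "closures f (u @ v) = closures f (v @ u)"
  unfolding closures_def walk_append by (subst sum.swap) (simp add: mult.commute)

lemma closures_reverse: "closures f (reverse w) = closures f w"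
  by (simp add: closures_def walk_reverse)

lemma closures_reverse_append:
  "closures f (reverse u @ v) = (\<Sum>a \<in> UNIV. \<Sum>c \<in> UNIV. walk f c u a * walk f c v a)"
  by (simp add: closures_def walk_append walk_reverse)

lemma closures_Cons: "closures f (x # w) = walk f (leave f x) w (enter f x)"
  by (cases "enter f x") (simp_all add: closures_def UNIV_bool)

lemma closures_Nil: "closures f [] = 2"
  by (simp add: closures_def UNIV_bool)

lemma sum_color_pairs:
  "(\<Sum>v \<in> UNIV. g v) = g (False, False) + g (False, True) + g (True, False) + g (True, True)"
  for g :: "bool \<times> bool \<Rightarrow> nat"
  by (simp flip: UNIV_Times_UNIV sum.cartesian_product add: UNIV_bool)

lemma walk_upd: "A \<notin> fst ` set w \<Longrightarrow> walk (f(A := v)) a w b = walk f a w b"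
  by (rule walk_cong) auto

text \<open>
  Summing over the two colors at \<open>A\<close> contracts the tensor of the smoothing, which is a product of two
  Kronecker deltas. The deltas reconnect the remaining paths exactly as the corresponding rule of
  resolution does; this is the reason for the next four identities.
\<close>

lemma closures_split:
  assumes "A \<notin> fst ` set x" "A \<notin> fst ` set y"
  shows "(\<Sum>v \<in> UNIV. closures (f(A := v)) ((A, i) # x @ (A, \<not> i) # y))
    = closures f x * closures f y"
  unfolding closures_Cons walk_through sum_color_pairs
  by (cases i) (simp_all add: closures_def walk_upd[OF assms(1)] walk_upd[OF assms(2)] UNIV_bool
      algebra_simps)

lemma closures_split_reversing:
  assumes "A \<notin> fst ` set x" "A \<notin> fst ` set y"
  shows "(\<Sum>v \<in> UNIV. closures (f(A := v)) ((A, i) # x @ (A, i) # y))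
    = closures f (reverse x @ y)"
  unfolding closures_Cons walk_through sum_color_pairs closures_reverse_append
  by (cases i) (simp_all add: walk_upd[OF assms(1)] walk_upd[OF assms(2)] UNIV_bool)

lemma closures_merge:
  assumes "A \<notin> fst ` set x" "A \<notin> fst ` set y"
  shows "(\<Sum>v \<in> UNIV. closures (f(A := v)) ((A, i) # x) * closures (f(A := v)) ((A, \<not> i) # y))
    = closures f (x @ y)"
  unfolding closures_Cons sum_color_pairs
  by (cases i) (simp_all add: closures_def walk_append walk_upd[OF assms(1)] walk_upd[OF assms(2)]
      UNIV_bool)

lemma closures_merge_reversing:
  assumes "A \<notin> fst ` set x" "A \<notin> fst ` set y"
  shows "(\<Sum>v \<in> UNIV. closures (f(A := v)) ((A, i) # x) * closures (f(A := v)) ((A, i) # y))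
    = closures f (reverse x @ y)"
  unfolding closures_Cons sum_color_pairs closures_reverse_append
  by (cases i) (simp_all add: walk_upd[OF assms(1)] walk_upd[OF assms(2)] UNIV_bool)

lemma colorings_delete_letter:
  assumes "letters Q = insert A (letters Q')" "A \<notin> letters Q'"
    and "\<And>f. (\<Sum>v \<in> UNIV. closures_phrase (f(A := v)) Q) = closures_phrase f Q'"
  shows "colorings Q = colorings Q'"
  by (simp add: colorings_def assms(1) sum_PiE_insert[OF assms(2)] assms(3))

lemma colorings_cong:
  assumes "letters Q = letters Q'" "\<And>f. closures_phrase f Q = closures_phrase f Q'"
  shows "colorings Q = colorings Q'"
  by (simp add: colorings_def assms)

text \<open>
  The resolution of \<open>A\<close> concerns one or two components only; the factors of the others do not involve
  the color of \<open>A\<close> and come out of the sum.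
\<close>

lemma colorings_replace:
  assumes "A \<notin> letters (us @ Q' @ vs)" "letters Q = insert A (letters Q')"
    and "\<And>f. (\<Sum>v \<in> UNIV. closures_phrase (f(A := v)) Q) = closures_phrase f Q'"
  shows "colorings (us @ Q @ vs) = colorings (us @ Q' @ vs)"
proof (rule colorings_delete_letter[OF _ assms(1)])
  show "letters (us @ Q @ vs) = insert A (letters (us @ Q' @ vs))"
    using assms(2) by simp
  fix f
  have "closures_phrase (f(A := v)) us = closures_phrase f us"
    "closures_phrase (f(A := v)) vs = closures_phrase f vs" for v
    using assms(1) by (auto intro!: closures_phrase_cong)
  then have "(\<Sum>v \<in> UNIV. closures_phrase (f(A := v)) (us @ Q @ vs))
      = (\<Sum>v \<in> UNIV. closures_phrase f us * (closures_phrase (f(A := v)) Q * closures_phrase f vs))"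
    by simp
  also have "\<dots> = closures_phrase f us * ((\<Sum>v \<in> UNIV. closures_phrase (f(A := v)) Q)
      * closures_phrase f vs)"
    by (simp only: sum_distrib_left sum_distrib_right)
  finally show "(\<Sum>v \<in> UNIV. closures_phrase (f(A := v)) (us @ Q @ vs))
      = closures_phrase f (us @ Q' @ vs)"
    using assms(3)[of f] by simp
qed

section \<open>Colorings under the resolution of a letter\<close>

text \<open>
  The tags carry the same information as the signs and markers: those of \<open>A\<close> differ if and only if
  \<open>mark A = p A\<close>. As \<open>A\<close> occurs twice, this says that its tag \<open>True\<close> occurs an odd number of times, and
  parity is easy to follow when a part of the phrase is reversed.
\<close>

definition encodes ::
  "('l \<Rightarrow> int) \<Rightarrow> ('l \<Rightarrow> int) \<Rightarrow> 'l list list \<Rightarrow> 'l passage list list \<Rightarrow> bool" where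
  "encodes mark p P Q \<longleftrightarrow>
     map (map fst) Q = P \<and>
     (\<forall>A \<in> set (concat P). count_list (concat P) A = 2 \<and> p A \<in> {1, -1} \<and> mark A \<in> {1, -1} \<and>
       (odd (count_list (concat Q) (A, True)) \<longleftrightarrow> mark A = p A))"

lemma letters_eq: "letters Q = set (concat (map (map fst) Q))"
  by (induction Q) auto

lemma count_passages:
  "count_list (map fst w) A = count_list w (A, True) + count_list w (A, False)"
proof (induction w)
  case (Cons x w)
  then show ?case by (cases x; cases "snd x") auto
qed simp

lemma map_fst_reverse [simp]: "map fst (reverse w) = rev (map fst w)"
  by (simp add: reverse_def rev_map o_def)

lemma set_reverse [simp]: "fst ` set (reverse w) = fst ` set w"
  by (simp add: reverse_def image_image)

lemma count_reverse: "count_list (reverse w) (A, i) = count_list w (A, \<not> i)"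
  by (induction w) (auto simp: reverse_def flip_def)

lemma even_count_reverse:
  "even (count_list (reverse w) (A, True)) \<longleftrightarrow>
    even (count_list w (A, True)) = even (count_list (map fst w) A)"
  by (auto simp: count_reverse count_passages)

lemma count_le_2_odd: "n \<le> 2 \<Longrightarrow> odd n \<longleftrightarrow> n = 1" for n :: nat
  by (auto simp: le_Suc_eq numeral_2_eq_2)

text \<open>
  Reversing \<open>w\<close> flips its tags, which changes whether the two tags of \<open>A\<close> agree just if \<open>A\<close> occurs once
  in \<open>w\<close>. This is why an inversion has to negate the signs of those letters.
\<close>

lemma negate_once_eq_iff:
  assumes "count_list w A \<le> 2" "p A \<in> {1, -1}" "m \<in> {1, -1}"
  shows "m = negate_once w p A \<longleftrightarrow> (m = p A) \<noteq> odd (count_list w A)"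
    and "negate_once w p A \<in> {1, -1}"
  using assms by (auto simp: negate_once_def count_le_2_odd)

lemma encodes_split_word:
  assumes "encodes mark p (us @ ws @ vs) Q"
  obtains us' ws' vs' where "Q = us' @ ws' @ vs'" "map (map fst) us' = us"
    "map (map fst) ws' = ws" "map (map fst) vs' = vs"
  using assms by (auto simp: encodes_def map_eq_append_conv append_eq_map_conv)

lemma encodes_tags:
  assumes "encodes mark p P Q" "A \<in> set (concat P)"
  shows "mark A = p A \<longleftrightarrow> count_list (concat Q) (A, True) = 1"
    and "mark A = - p A \<longleftrightarrow> count_list (concat Q) (A, True) \<noteq> 1"
    and "count_list (concat Q) (A, True) + count_list (concat Q) (A, False) = 2"
proof -
  have "count_list (map fst (concat Q)) A = 2"
    using assms by (auto simp: encodes_def map_concat)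
  then show sum: "count_list (concat Q) (A, True) + count_list (concat Q) (A, False) = 2"
    by (simp add: count_passages)
  have "odd (count_list (concat Q) (A, True)) \<longleftrightarrow> mark A = p A" "p A \<in> {1, -1}" "mark A \<in> {1, -1}"
    using assms by (auto simp: encodes_def)
  with sum show "mark A = p A \<longleftrightarrow> count_list (concat Q) (A, True) = 1"
    and "mark A = - p A \<longleftrightarrow> count_list (concat Q) (A, True) \<noteq> 1"
    by (auto simp: count_le_2_odd)
qed

text \<open>
  The four deletion rules have this common form, where \<open>w\<close> is the part that is reversed (empty for the
  two rules that respect orientation) and \<open>R\<close> is what the components \<open>ws'\<close> containing \<open>A\<close> become.
\<close>

lemma encodes_delete_letter:
  assumes enc: "encodes mark p (us @ ws @ vs) (us' @ ws' @ vs')"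
    and maps: "map (map fst) us' = us" "map (map fst) ws' = ws" "map (map fst) vs' = vs"
    and ws: "\<And>B. count_list (concat ws) B
      = (if B = A then 2 else 0) + count_list (concat (map (map fst) R)) B"
    and w: "\<And>B. B \<noteq> A \<Longrightarrow> count_list w B \<le> count_list (concat ws) B"
    and odd: "\<And>B. B \<noteq> A \<Longrightarrow> odd (count_list (concat R) (B, True)) \<longleftrightarrow>
      odd (count_list (concat ws') (B, True)) \<noteq> odd (count_list w B)"
    and closures: "\<And>f. A \<notin> letters R \<Longrightarrow>
      (\<Sum>v \<in> UNIV. closures_phrase (f(A := v)) ws') = closures_phrase f R"
  shows "encodes mark (negate_once w p) (us @ map (map fst) R @ vs) (us' @ R @ vs')"
    and "colorings (us' @ R @ vs') = colorings (us' @ ws' @ vs')"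
proof -
  have in_ws: "B \<in> set (concat ws) \<longleftrightarrow> B = A \<or> B \<in> set (concat (map (map fst) R))" for B
  proof -
    have "B \<in> set (concat ws) \<longleftrightarrow> count_list (concat ws) B \<noteq> 0"
      by (simp only: count_list_0_iff not_not)
    also have "\<dots> \<longleftrightarrow> B = A \<or> count_list (concat (map (map fst) R)) B \<noteq> 0"
      unfolding ws[of B] by simp
    finally show ?thesis
      by (simp only: count_list_0_iff not_not)
  qed
  have A: "A \<in> set (concat ws)"
    using in_ws by blast
  then have "count_list (concat (us @ ws @ vs)) A = 2"
    using enc by (auto simp: encodes_def)
  then have zero: "count_list (concat us) A = 0" "count_list (concat vs) A = 0"
    "count_list (concat (map (map fst) R)) A = 0"
    using ws[of A] by simp_all
  then have notin: "A \<notin> set (concat us)" "A \<notin> set (concat vs)" "A \<notin> set (concat (map (map fst) R))"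
    unfolding count_list_0_iff .
  have letters: "letters us' = set (concat us)" "letters vs' = set (concat vs)"
    "letters ws' = set (concat ws)" "letters R = set (concat (map (map fst) R))"
    by (simp_all only: letters_eq maps)
  show "encodes mark (negate_once w p) (us @ map (map fst) R @ vs) (us' @ R @ vs')"
    unfolding encodes_def
  proof (intro conjI ballI)
    show "map (map fst) (us' @ R @ vs') = us @ map (map fst) R @ vs"
      using maps by simp
    fix B assume B: "B \<in> set (concat (us @ map (map fst) R @ vs))"
    then have "B \<noteq> A" using notin by auto
    have "B \<in> set (concat (us @ ws @ vs))" using B in_ws[of B] by auto
    then have encB: "count_list (concat (us @ ws @ vs)) B = 2" "p B \<in> {1, -1}" "mark B \<in> {1, -1}"
      "odd (count_list (concat (us' @ ws' @ vs')) (B, True)) \<longleftrightarrow> mark B = p B"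
      using enc by (auto simp: encodes_def)
    have "count_list w B \<le> 2" using w[OF \<open>B \<noteq> A\<close>] encB(1) by simp
    note neg = negate_once_eq_iff[where p = p, OF this encB(2,3)]
    show "count_list (concat (us @ map (map fst) R @ vs)) B = 2"
      using encB(1) ws[of B] \<open>B \<noteq> A\<close> by simp
    show "mark B \<in> {1, -1}" by (fact encB)
    show "negate_once w p B \<in> {1, -1}" by (fact neg)
    show "odd (count_list (concat (us' @ R @ vs')) (B, True)) \<longleftrightarrow> mark B = negate_once w p B"
      unfolding neg(1) encB(4)[symmetric] using odd[OF \<open>B \<noteq> A\<close>] by auto
  qed
  show "colorings (us' @ R @ vs') = colorings (us' @ ws' @ vs')"
  proof (rule colorings_replace[symmetric])
    show "A \<notin> letters (us' @ R @ vs')"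
      using notin letters by simp
    show "letters ws' = insert A (letters R)"
      unfolding letters using in_ws by auto
    show "(\<Sum>v \<in> UNIV. closures_phrase (f(A := v)) ws') = closures_phrase f R" for f
      by (rule closures) (use notin letters in simp)
  qed
qed

lemma mset_concat_cong: "mset P = mset P' \<Longrightarrow> mset (concat P) = mset (concat P')"
  unfolding mset_concat by (metis mset_map sum_mset_sum_list)

text \<open>
  The number of colorings is an invariant of resolution; this makes the number of circles of a state
  independent of the order and the manner in which its letters are deleted.
\<close>

lemma resolve_step_colorings:
  assumes "resolve_step mark C C'" "encodes mark (fst C) (snd C) Q"
  shows "\<exists>Q'. encodes mark (fst C') (snd C') Q' \<and> colorings Q' = colorings Q"
  using assms
proof (induction rule: resolve_step.cases)
  case (shift p us x y vs)
  then have enc: "encodes mark p (us @ [x @ y] @ vs) Q" by simp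
  from encodes_split_word[OF this] obtain us' ws' vs' where *: "Q = us' @ ws' @ vs'"
    "map (map fst) us' = us" "map (map fst) ws' = [x @ y]" "map (map fst) vs' = vs" .
  then obtain x' y' where xy: "ws' = [x' @ y']" "map fst x' = x" "map fst y' = y"
    by (auto simp: map_eq_append_conv map_eq_Cons_conv)
  show ?case
  proof (intro exI conjI)
    show "encodes mark (fst C') (snd C') (us' @ [y' @ x'] @ vs')"
      using enc * xy shift by (auto simp: encodes_def ac_simps)
    show "colorings (us' @ [y' @ x'] @ vs') = colorings Q"
      unfolding * xy
      by (rule colorings_cong) (auto simp: closures_shift[of _ x' y'])
  qed
next
  case (permute P P' p)
  then have enc: "encodes mark p P Q" by simp
  then have "list_all2 (\<lambda>w v. w = map fst v) P Q"
    by (auto simp: encodes_def list_all2_conv_all_nth)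
  from list_all2_reorder_left_invariance[OF this, of P'] permute obtain Q' where
    Q': "list_all2 (\<lambda>w v. w = map fst v) P' Q'" "mset Q' = mset Q"
    by auto
  have "mset (concat Q') = mset (concat Q)" "mset (concat P') = mset (concat P)"
    by (rule mset_concat_cong, use Q'(2) permute in simp)+
  then have count: "count_list (concat Q') A = count_list (concat Q) A"
    "count_list (concat P') B = count_list (concat P) B"
    and set: "set (concat Q') = set (concat Q)" "set (concat P') = set (concat P)" for A B
    by (metis count_mset, metis count_mset, metis mset_eq_setD, metis mset_eq_setD)
  have "map (map fst) Q' = P'"
    using Q'(1) by (auto simp: list_all2_conv_all_nth intro: nth_equalityI)
  then have "encodes mark p P' Q'"
    using enc unfolding encodes_def count set by blast
  moreover have "colorings Q' = colorings Q"
  proof (rule colorings_cong)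
    show "letters Q' = letters Q" by (simp only: letters_def set)
    show "closures_phrase f Q' = closures_phrase f Q" for f
      unfolding closures_phrase_def using Q'(2) by (metis mset_map prod_mset_prod_list)
  qed
  ultimately show ?case using permute by auto
next
  case (invert p us w vs)
  then have enc: "encodes mark p (us @ [w] @ vs) Q" by simp
  from encodes_split_word[OF this] obtain us' ws' vs' where *: "Q = us' @ ws' @ vs'"
    "map (map fst) us' = us" "map (map fst) ws' = [w]" "map (map fst) vs' = vs" .
  then obtain w' where w: "ws' = [w']" "map fst w' = w"
    by auto
  show ?case
  proof (intro exI conjI)
    show "encodes mark (fst C') (snd C') (us' @ [reverse w'] @ vs')"
      unfolding encodes_def
    proof (intro conjI ballI)
      show "map (map fst) (us' @ [reverse w'] @ vs') = snd C'"
        using * w invert by simp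
      fix A assume "A \<in> set (concat (snd C'))"
      then have A: "count_list (concat (us @ [w] @ vs)) A = 2" "p A \<in> {1, -1}" "mark A \<in> {1, -1}"
        "odd (count_list (concat Q) (A, True)) \<longleftrightarrow> mark A = p A"
        using enc invert by (auto simp: encodes_def)
      then have "count_list w A \<le> 2" by simp
      note neg = negate_once_eq_iff[where p = p, OF this A(2,3)]
      show "count_list (concat (snd C')) A = 2" "mark A \<in> {1, -1}" using A invert by auto
      show "fst C' A \<in> {1, -1}" using neg(2) invert by simp
      show "odd (count_list (concat (us' @ [reverse w'] @ vs')) (A, True)) \<longleftrightarrow> mark A = fst C' A"
        using A(4) neg(1) invert * w by (auto simp: even_count_reverse)
    qed
    show "colorings (us' @ [reverse w'] @ vs') = colorings Q"
      unfolding * w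
      by (rule colorings_cong) (auto simp: closures_reverse)
  qed
next
  case (split_pos A p us x y vs)
  then have enc: "encodes mark p (us @ [[A] @ x @ [A] @ y] @ vs) Q" by simp
  from encodes_split_word[OF this] obtain us' ws' vs' where *: "Q = us' @ ws' @ vs'"
    "map (map fst) us' = us" "map (map fst) ws' = [[A] @ x @ [A] @ y]" "map (map fst) vs' = vs" .
  then obtain i j x' y' where w: "ws' = [(A, i) # x' @ (A, j) # y']" "map fst x' = x" "map fst y' = y"
    by (auto simp: map_eq_append_conv map_eq_Cons_conv)
  \<comment> \<open>the tags of \<open>A\<close> differ since its marker equals its sign\<close>
  have ij: "j = (\<not> i)"
    using encodes_tags[OF enc, of A] split_pos * w by (cases i; cases j) auto
  let ?R = "[x', y']"
  note del = encodes_delete_letter[OF enc[unfolded *(1)] *(2,3,4), of A ?R "[]"]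
  have "encodes mark (negate_once [] p) (us @ map (map fst) ?R @ vs) (us' @ ?R @ vs')"
    "colorings (us' @ ?R @ vs') = colorings (us' @ ws' @ vs')"
    by (rule del; use w ij in \<open>auto simp: image_Un even_count_reverse closures_split\<close>)+
  then show ?case
    using split_pos * w by (intro exI[of _ "us' @ ?R @ vs'"]) (simp add: negate_once_def)
next
  case (split_neg A p us x y vs)
  then have enc: "encodes mark p (us @ [[A] @ x @ [A] @ y] @ vs) Q" by simp
  from encodes_split_word[OF this] obtain us' ws' vs' where *: "Q = us' @ ws' @ vs'"
    "map (map fst) us' = us" "map (map fst) ws' = [[A] @ x @ [A] @ y]" "map (map fst) vs' = vs" .
  then obtain i j x' y' where w: "ws' = [(A, i) # x' @ (A, j) # y']" "map fst x' = x" "map fst y' = y"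
    by (auto simp: map_eq_append_conv map_eq_Cons_conv)
  \<comment> \<open>the tags of \<open>A\<close> agree since its marker is opposite to its sign\<close>
  have ij: "j = i"
    using encodes_tags[OF enc, of A] split_neg * w by (cases i; cases j) auto
  let ?R = "[reverse x' @ y']"
  note del = encodes_delete_letter[OF enc[unfolded *(1)] *(2,3,4), of A ?R "x"]
  have "encodes mark (negate_once x p) (us @ map (map fst) ?R @ vs) (us' @ ?R @ vs')"
    "colorings (us' @ ?R @ vs') = colorings (us' @ ws' @ vs')"
    by (rule del; use w ij in \<open>auto simp: image_Un even_count_reverse closures_split_reversing\<close>)+
  then show ?case
    using split_neg * w by (intro exI[of _ "us' @ ?R @ vs'"]) simp
next
  case (merge_pos A p us x y vs)
  then have enc: "encodes mark p (us @ [[A] @ x, [A] @ y] @ vs) Q" by simp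
  from encodes_split_word[OF this] obtain us' ws' vs' where *: "Q = us' @ ws' @ vs'"
    "map (map fst) us' = us" "map (map fst) ws' = [[A] @ x, [A] @ y]" "map (map fst) vs' = vs" .
  then obtain i j x' y' where w: "ws' = [(A, i) # x', (A, j) # y']" "map fst x' = x" "map fst y' = y"
    by (auto simp: map_eq_append_conv map_eq_Cons_conv)
  \<comment> \<open>the tags of \<open>A\<close> differ since its marker equals its sign\<close>
  have ij: "j = (\<not> i)"
    using encodes_tags[OF enc, of A] merge_pos * w by (cases i; cases j) auto
  let ?R = "[x' @ y']"
  note del = encodes_delete_letter[OF enc[unfolded *(1)] *(2,3,4), of A ?R "[]"]
  have "encodes mark (negate_once [] p) (us @ map (map fst) ?R @ vs) (us' @ ?R @ vs')"
    "colorings (us' @ ?R @ vs') = colorings (us' @ ws' @ vs')"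
    by (rule del; use w ij in \<open>auto simp: image_Un even_count_reverse closures_merge\<close>)+
  then show ?case
    using merge_pos * w by (intro exI[of _ "us' @ ?R @ vs'"]) (simp add: negate_once_def)
next
  case (merge_neg A p us x y vs)
  then have enc: "encodes mark p (us @ [[A] @ x, [A] @ y] @ vs) Q" by simp
  from encodes_split_word[OF this] obtain us' ws' vs' where *: "Q = us' @ ws' @ vs'"
    "map (map fst) us' = us" "map (map fst) ws' = [[A] @ x, [A] @ y]" "map (map fst) vs' = vs" .
  then obtain i j x' y' where w: "ws' = [(A, i) # x', (A, j) # y']" "map fst x' = x" "map fst y' = y"
    by (auto simp: map_eq_append_conv map_eq_Cons_conv)
  \<comment> \<open>the tags of \<open>A\<close> agree since its marker is opposite to its sign\<close>
  have ij: "j = i"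
    using encodes_tags[OF enc, of A] merge_neg * w by (cases i; cases j) auto
  let ?R = "[reverse x' @ y']"
  note del = encodes_delete_letter[OF enc[unfolded *(1)] *(2,3,4), of A ?R "x"]
  have "encodes mark (negate_once x p) (us @ map (map fst) ?R @ vs) (us' @ ?R @ vs')"
    "colorings (us' @ ?R @ vs') = colorings (us' @ ws' @ vs')"
    by (rule del; use w ij in \<open>auto simp: image_Un even_count_reverse closures_merge_reversing\<close>)+
  then show ?case
    using merge_neg * w by (intro exI[of _ "us' @ ?R @ vs'"]) simp
qed

section \<open>The number of circles of a state\<close>

lemma resolves_colorings:
  assumes "(resolve_step mark)\<^sup>*\<^sup>* C C'" "encodes mark (fst C) (snd C) Q"
  shows "\<exists>Q'. encodes mark (fst C') (snd C') Q' \<and> colorings Q' = colorings Q"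
  using assms
proof induction
  case (step C' C'')
  then show ?case by (metis resolve_step_colorings)
qed auto

lemma resolve_step_nonempty:
  assumes "resolve_step mark C C'" "snd C \<noteq> []"
  shows "snd C' \<noteq> []"
  using assms by cases (auto dest: arg_cong[of _ _ size])

lemma resolves_nonempty:
  assumes "(resolve_step mark)\<^sup>*\<^sup>* C C'" "snd C \<noteq> []"
  shows "snd C' \<noteq> []"
  using assms by induction (auto dest: resolve_step_nonempty)

lemma colorings_empty_words: "colorings (replicate n []) = 2 ^ n"
proof -
  have "letters (replicate n []) = ({} :: 'a set)"
    by (simp add: letters_def)
  moreover have "closures_phrase f (replicate n []) = 2 ^ n" for f :: "'a \<Rightarrow> bool \<times> bool"
    by (simp add: closures_phrase_def closures_Nil prod_list_replicate)
  ultimately show ?thesis by (simp add: colorings_def)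
qed

lemma map_map_fst_replicate: "map (map fst) Q = replicate n [] \<Longrightarrow> Q = replicate n []"
  by (induction n arbitrary: Q) (auto simp: map_eq_Cons_conv)

lemma bring_letter_to_front:
  assumes "A \<in> set (concat P)"
  obtains us x vs where "resolve_step mark (p, P) (p, us @ [A # x] @ vs)"
    "length (concat (us @ [A # x] @ vs)) = length (concat P)"
proof -
  from assms obtain w where "w \<in> set P" "A \<in> set w" by auto
  then obtain us vs u v where "P = us @ [u @ A # v] @ vs"
    by (metis append_Cons append_Nil split_list)
  with resolve_step.shift[of mark p us u "A # v" vs] that[of us "v @ u" vs] show thesis
    by simp
qed

text \<open>
  Shift a component so that it begins with \<open>A\<close>. If \<open>A\<close> occurs in it again, a split applies; otherwise
  move the component with the second \<open>A\<close> behind it, shift that one too, and merge.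
\<close>

lemma ex_deleting_step:
  assumes "encodes mark p P Q" "A \<in> set (concat P)"
  shows "\<exists>p' P'. (resolve_step mark)\<^sup>*\<^sup>* (p, P) (p', P') \<and> length (concat P') < length (concat P)"
proof -
  obtain us x vs where front: "resolve_step mark (p, P) (p, us @ [A # x] @ vs)"
    and len: "length (concat (us @ [A # x] @ vs)) = length (concat P)"
    using bring_letter_to_front[OF assms(2)] .
  \<comment> \<open>markers and signs are \<open>\<plusminus>1\<close>, so that one of the two kinds of deletion is applicable\<close>
  have sign: "mark A = p A \<or> mark A = - p A"
    using encodes_tags[OF assms] by blast
  from resolve_step_colorings[OF front] assms obtain Q' where
    "encodes mark p (us @ [A # x] @ vs) Q'"
    by auto
  then have "count_list (concat (us @ [A # x] @ vs)) A = 2"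
    by (auto simp: encodes_def)
  then have "A \<in> set x \<or> A \<in> set (concat (us @ vs))"
    using count_list_0_iff[of "concat us" A] count_list_0_iff[of "concat vs" A]
      count_list_0_iff[of x A] by auto
  then show ?thesis
  proof
    assume "A \<in> set x"
    then obtain y z where x: "x = y @ A # z" by (metis split_list)
    have "\<exists>p' P'. resolve_step mark (p, us @ [A # x] @ vs) (p', P')
        \<and> length (concat P') < length (concat (us @ [A # x] @ vs))"
      using sign
    proof
      assume "mark A = p A"
      from split_pos[of mark A p us y z vs, OF this] show ?thesis
        by (intro exI conjI) (auto simp: x)
    next
      assume "mark A = - p A"
      from split_neg[of mark A p us y z vs, OF this] show ?thesis
        by (intro exI conjI) (auto simp: x)
    qed
    with front len show ?thesis
      by (metis converse_rtranclp_into_rtranclp r_into_rtranclp)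
  next
    assume "A \<in> set (concat (us @ vs))"
    then obtain w where "w \<in> set (us @ vs)" "A \<in> set w" by auto
    then obtain us' vs' u v where w: "us @ vs = us' @ [u @ A # v] @ vs'"
      by (metis append_Cons append_Nil split_list)
    have "mset (us @ vs) = mset (us' @ [u @ A # v] @ vs')"
      by (simp only: w)
    then have "mset (us @ [A # x] @ vs) = mset (((us' @ vs') @ [A # x]) @ [u @ A # v] @ [])"
      by simp
    note steps = resolve_step.permute[OF this, of mark p]
      resolve_step.shift[of mark p "(us' @ vs') @ [A # x]" u "A # v" "[]"]
    have "\<exists>p' P'. resolve_step mark (p, ((us' @ vs') @ [A # x]) @ [(A # v) @ u] @ []) (p', P')
        \<and> length (concat P') < length (concat (us @ [A # x] @ vs))"
      using sign
    proof
      have len': "length (concat us) + length (concat vs)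
        = length (concat us') + length (concat vs') + length u + length v + 1"
        using arg_cong[OF w, of "\<lambda>P. length (concat P)"] by simp
      {
        assume "mark A = p A"
        from merge_pos[of mark A p "us' @ vs'" x "v @ u" "[]", OF this] show ?thesis
          by (intro exI conjI) (use len' in auto)
      next
        assume "mark A = - p A"
        from merge_neg[of mark A p "us' @ vs'" x "v @ u" "[]", OF this] show ?thesis
          by (intro exI conjI) (use len' in auto)
      }
    qed
    then obtain p' P' where last:
      "resolve_step mark (p, ((us' @ vs') @ [A # x]) @ [(A # v) @ u] @ []) (p', P')"
      and less: "length (concat P') < length (concat (us @ [A # x] @ vs))"
      by blast
    let ?R = "(resolve_step mark)\<^sup>*\<^sup>*"
    note prepend = converse_rtranclp_into_rtranclp[where r = "resolve_step mark"]
    have "?R (p, P) (p', P')"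
      by (rule prepend[OF front prepend[OF steps(1) prepend[OF steps(2)]]] r_into_rtranclp last)+
    with less len show ?thesis by auto
  qed
qed

lemma ex_resolution:
  "encodes mark p P Q \<Longrightarrow> \<exists>p' n. (resolve_step mark)\<^sup>*\<^sup>* (p, P) (p', replicate n [])"
proof (induction "length (concat P)" arbitrary: p P Q rule: less_induct)
  case less
  show ?case
  proof (cases "set (concat P) = {}")
    case True
    then have "P = replicate (length P) []"
      by (intro replicate_eqI) auto
    then show ?thesis by (metis rtranclp.rtrancl_refl)
  next
    case False
    then obtain A where "A \<in> set (concat P)" by (meson equals0I)
    from ex_deleting_step[OF less.prems this] obtain p' P' where
      step: "(resolve_step mark)\<^sup>*\<^sup>* (p, P) (p', P')" "length (concat P') < length (concat P)"
      by blast
    from resolves_colorings[OF this(1)] less.prems obtain Q' where "encodes mark p' P' Q'"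
      by auto
    from less.hyps[OF step(2) this] step(1) show ?thesis
      by (meson rtranclp_trans)
  qed
qed

text \<open>
  A resolution exists, and it preserves the number of colorings, which for \<open>n\<close> empty words is \<open>2 ^ n\<close>.
  So the exponent in the state sum can be read off from any encoding. It is positive since no step
  produces the empty phrase from a nonempty one; this matters for the truncated \<open>n - 1\<close> in the exponent.
\<close>

lemma state_components_colorings:
  assumes "encodes s (proj N) (phrase N) Q" "phrase N \<noteq> []"
  shows "colorings Q = 2 ^ state_components N s" "state_components N s \<ge> 1"
proof -
  have count: "colorings Q = 2 ^ n \<and> n \<ge> 1"
    if reach: "(resolve_step s)\<^sup>*\<^sup>* (proj N, phrase N) (p, replicate n [])" for n p
  proof -
    from resolves_colorings[OF reach] assms(1) obtain Q' where
      "encodes s p (replicate n []) Q'" "colorings Q' = colorings Q"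
      by auto
    moreover from this have "Q' = replicate n []"
      by (simp add: encodes_def map_map_fst_replicate)
    ultimately have "colorings Q = 2 ^ n"
      by (metis colorings_empty_words)
    then show ?thesis
      using resolves_nonempty[OF reach] assms(2) by (simp add: Suc_le_eq)
  qed
  obtain p n where reach: "(resolve_step s)\<^sup>*\<^sup>* (proj N, phrase N) (p, replicate n [])"
    using ex_resolution[OF assms(1)] by blast
  have "state_components N s = n"
    unfolding state_components_def
  proof (rule the_equality)
    fix m assume "\<exists>p. (resolve_step s)\<^sup>*\<^sup>* (proj N, phrase N) (p, replicate m [])"
    then have "(2::nat) ^ m = 2 ^ n" using count count[OF reach] by metis
    then show "m = n" by simp
  qed (use reach in blast)
  then show "colorings Q = 2 ^ state_components N s" "state_components N s \<ge> 1"
    using count[OF reach] by simp_all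
qed

section \<open>The coloring count as a contraction along the word\<close>

lemma components_ne [simp]: "components u \<noteq> []"
  by (induction u rule: components.induct) auto

lemma components_map: "components (map (map_option h) u) = map (map h) (components u)"
  by (induction u rule: components.induct) (auto simp: hd_map map_tl)

lemma concat_components: "concat (components u) = map the (filter (\<lambda>a. a \<noteq> None) u)"
proof (induction u rule: components.induct)
  case (3 A u)
  then show ?case by (cases "components u") auto
qed auto

lemma count_concat_components: "count_list (concat (components u)) A = count_list u (Some A)"
  unfolding concat_components by (induction u) auto

lemma set_concat_components: "A \<in> set (concat (components u)) \<longleftrightarrow> Some A \<in> set u"
  unfolding concat_components by force

text \<open>
  The places of a move may lie on the same or on different components, in many configurations. Reading
  the whole phrase as one word with separators treats them alike: the state of the reader is the pair of
  the color in which the current component began and the current color. At a separator the two have to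
  agree, and the next component starts in an arbitrary color. So every word has a matrix, and
  concatenation is multiplication of matrices.
\<close>

fun sweep :: "('l \<Rightarrow> bool \<times> bool) \<Rightarrow> 'l passage option list \<Rightarrow> bool \<times> bool \<Rightarrow> bool \<times> bool \<Rightarrow> nat" where
  "sweep f [] r q = of_bool (r = q)"
| "sweep f (Some x # u) r q = of_bool (snd r = enter f x) * sweep f u (fst r, leave f x) q"
| "sweep f (None # u) r q = of_bool (fst r = snd r) * (\<Sum>c \<in> UNIV. sweep f u (c, c) q)"

lemma sum_pair_delta:
  "(\<Sum>r \<in> UNIV. of_bool (q = r) * F r) = F q" for F :: "bool \<times> bool \<Rightarrow> nat"
  by (cases q rule: prod.exhaust; cases "fst q"; cases "snd q") (auto simp: sum_color_pairs)

lemma sweep_append: "sweep f (u @ v) r q = (\<Sum>k \<in> UNIV. sweep f u r k * sweep f v k q)"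
proof (induction f u r q rule: sweep.induct)
  case (1 f r q)
  show ?case by (simp add: sum_pair_delta)
next
  case (2 f x u r q)
  then show ?case by (simp add: sum_distrib_left mult.assoc)
next
  case (3 f u r q)
  have "(\<Sum>c \<in> UNIV. sweep f (u @ v) (c, c) q)
    = (\<Sum>k \<in> UNIV. (\<Sum>c \<in> UNIV. sweep f u (c, c) k) * sweep f v k q)"
    unfolding sum_distrib_right by (subst sum.swap) (simp add: 3)
  then show ?case by (simp add: sum_distrib_left mult.assoc)
qed

lemma closures_phrase_components:
  "closures_phrase f (components u)
    = (\<Sum>c \<in> UNIV. walk f c (hd (components u)) c * closures_phrase f (tl (components u)))"
  by (metis closures_phrase_simps(2) closures_def components_ne list.collapse sum_distrib_right)

lemma sweep_components:
  "(\<Sum>c \<in> UNIV. sweep f u r (c, c))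
    = walk f (snd r) (hd (components u)) (fst r) * closures_phrase f (tl (components u))"
proof (induction u arbitrary: r rule: components.induct)
  case 1
  show ?case by (cases r) (auto simp: UNIV_bool)
next
  case (2 u)
  have "(\<Sum>c \<in> UNIV. \<Sum>c' \<in> UNIV. sweep f u (c', c') (c, c))
    = closures_phrase f (components u)"
    by (subst sum.swap) (simp add: 2 closures_phrase_components)
  then show ?case by (auto simp flip: sum_distrib_left)
next
  case (3 x u)
  then show ?case by (simp add: mult.assoc flip: sum_distrib_left)
qed

definition trace :: "('l \<Rightarrow> bool \<times> bool) \<Rightarrow> 'l passage option list \<Rightarrow> nat" where
  "trace f u = (\<Sum>c \<in> UNIV. \<Sum>c' \<in> UNIV. sweep f u (c, c) (c', c'))"

lemma trace_eq_closures_phrase: "trace f u = closures_phrase f (components u)"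
  unfolding trace_def sweep_components closures_phrase_components by simp

lemma sweep_cong:
  assumes "\<And>A i. Some (A, i) \<in> set u \<Longrightarrow> f A = g A"
  shows "sweep f u r q = sweep g u r q"
  using assms
proof (induction u arbitrary: r rule: components.induct)
  case (3 x u)
  have "f (fst x) = g (fst x)" using "3.prems"[of "fst x" "snd x"] by simp
  moreover have "sweep f u r q = sweep g u r q" for r
    using "3.prems" by (intro "3.IH") auto
  ultimately show ?case by (simp add: enter_cong[of f x g] leave_cong[of f x g])
qed auto

lemma trace_expand:
  assumes "\<And>A i. Some (A, i) \<in> set (x @ y @ z @ t) \<Longrightarrow> g A = f A"
  shows "trace g (x @ m1 @ y @ m2 @ z @ m3 @ t) =
    (\<Sum>c \<in> UNIV. \<Sum>c' \<in> UNIV. \<Sum>r1 \<in> UNIV. \<Sum>q1 \<in> UNIV. \<Sum>r2 \<in> UNIV. \<Sum>q2 \<in> UNIV. \<Sum>r3 \<in> UNIV. \<Sum>q3 \<in> UNIV.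
      (sweep f x (c, c) r1 * sweep f y q1 r2 * sweep f z q2 r3 * sweep f t q3 (c', c')) *
      (sweep g m1 r1 q1 * sweep g m2 r2 q2 * sweep g m3 r3 q3))"
proof -
  have eq: "sweep f x = sweep g x" "sweep f y = sweep g y" "sweep f z = sweep g z"
    "sweep f t = sweep g t"
    by (intro ext sweep_cong; use assms in fastforce)+
  show ?thesis
    unfolding trace_def sweep_append sum_distrib_left eq
    by (intro sum.cong refl) (simp only: mult_ac)
qed

text \<open>
  Locality: the total count is linear in the tensor formed by the matrices of the three places \<open>m1\<close>,
  \<open>m2\<close>, \<open>m3\<close>, summed over the colors \<open>i\<close> of the letters that occur there, since the words around them
  do not see these colors. Proportional tensors thus give proportional counts, whatever surrounds them.
\<close>

lemma trace_replace:
  fixes g :: "'i \<Rightarrow> 'l \<Rightarrow> bool \<times> bool" and h :: "'j \<Rightarrow> 'l \<Rightarrow> bool \<times> bool"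
  assumes g: "\<And>i A k. i \<in> I \<Longrightarrow> Some (A, k) \<in> set (x @ y @ z @ t) \<Longrightarrow> g i A = f A"
    and h: "\<And>j A k. j \<in> J \<Longrightarrow> Some (A, k) \<in> set (x @ y @ z @ t) \<Longrightarrow> h j A = f A"
    and local: "\<And>r1 q1 r2 q2 r3 q3.
      (\<Sum>i \<in> I. sweep (g i) m1 r1 q1 * sweep (g i) m2 r2 q2 * sweep (g i) m3 r3 q3) =
      n * (\<Sum>j \<in> J. sweep (h j) m1' r1 q1 * sweep (h j) m2' r2 q2 * sweep (h j) m3' r3 q3)"
  shows "(\<Sum>i \<in> I. trace (g i) (x @ m1 @ y @ m2 @ z @ m3 @ t)) =
    n * (\<Sum>j \<in> J. trace (h j) (x @ m1' @ y @ m2' @ z @ m3' @ t))"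
proof -
  let ?env = "\<lambda>c c' r1 q1 r2 q2 r3 q3.
    sweep f x (c, c) r1 * sweep f y q1 r2 * sweep f z q2 r3 * sweep f t q3 (c', c')"
  let ?S = "\<lambda>loc. \<Sum>c \<in> UNIV. \<Sum>c' \<in> UNIV. \<Sum>r1 \<in> UNIV. \<Sum>q1 \<in> UNIV. \<Sum>r2 \<in> UNIV. \<Sum>q2 \<in> UNIV.
    \<Sum>r3 \<in> UNIV. \<Sum>q3 \<in> UNIV. ?env c c' r1 q1 r2 q2 r3 q3 * loc r1 q1 r2 q2 r3 q3 :: nat"
  have linear: "(\<Sum>k \<in> K. ?S (loc k)) = ?S (\<lambda>r1 q1 r2 q2 r3 q3. \<Sum>k \<in> K. loc k r1 q1 r2 q2 r3 q3)"
    for loc :: "'k \<Rightarrow> bool \<times> bool \<Rightarrow> bool \<times> bool \<Rightarrow> bool \<times> bool \<Rightarrow> bool \<times> bool \<Rightarrow> bool \<times> bool \<Rightarrow> bool \<times>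
        bool \<Rightarrow> nat"
      and K
    by ((rule trans[OF sum.swap], rule sum.cong[OF refl])+, simp only: sum_distrib_left)
  have scale: "?S (\<lambda>r1 q1 r2 q2 r3 q3. n * loc r1 q1 r2 q2 r3 q3) = n * ?S loc" for loc
    unfolding sum_distrib_left by (intro sum.cong refl) (simp only: mult_ac)
  have "(\<Sum>i \<in> I. trace (g i) (x @ m1 @ y @ m2 @ z @ m3 @ t)) =
    (\<Sum>i \<in> I. ?S (\<lambda>r1 q1 r2 q2 r3 q3. sweep (g i) m1 r1 q1 * sweep (g i) m2 r2 q2 * sweep
        (g i) m3 r3 q3))"
    by (intro sum.cong refl trace_expand) (rule g)
  also have "\<dots> = ?S (\<lambda>r1 q1 r2 q2 r3 q3.
      n * (\<Sum>j \<in> J. sweep (h j) m1' r1 q1 * sweep (h j) m2' r2 q2 * sweep (h j) m3' r3 q3))"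
    unfolding linear local ..
  also have "\<dots> = n * (\<Sum>j \<in> J. ?S (\<lambda>r1 q1 r2 q2 r3 q3.
      sweep (h j) m1' r1 q1 * sweep (h j) m2' r2 q2 * sweep (h j) m3' r3 q3))"
    unfolding scale linear ..
  also have "\<dots> = n * (\<Sum>j \<in> J. trace (h j) (x @ m1' @ y @ m2' @ z @ m3' @ t))"
    by (intro arg_cong[of _ _ "(*) n"] sum.cong refl trace_expand[symmetric]) (rule h)
  finally show ?thesis .
qed

section \<open>The local tensors of the three moves\<close>

definition pass :: "bool \<times> bool \<Rightarrow> bool \<Rightarrow> bool" where
  "pass v i = (if i then fst v else snd v)"

definition link :: "bool \<times> bool \<Rightarrow> bool \<Rightarrow> bool \<times> bool \<Rightarrow> bool \<Rightarrow> bool \<Rightarrow> bool \<Rightarrow> nat" where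
  "link u i v j a b = of_bool (a = pass u i \<and> pass u (\<not> i) = pass v j \<and> pass v (\<not> j) = b)"

text \<open>
  A word of two passages keeps the starting color of the component, so that only \<open>link\<close>, a function of
  the current colors, has to be known.
\<close>

lemma sweep_pair:
  "sweep f [Some (A, i), Some (B, j)] r q
      = of_bool (fst r = fst q) * link (f A) i (f B) j (snd r) (snd q)"
  by (cases q) (auto simp: link_def pass_def)

lemma sum_UNIV_prod: "(\<Sum>v \<in> UNIV. g v) = (\<Sum>a \<in> UNIV. \<Sum>b \<in> UNIV. g (a, b))"
  by (simp add: sum.cartesian_product)

text \<open>
  The tensors of the two sides of the third move, with the letters \<open>A\<close>, \<open>B\<close>, \<open>C\<close> colored \<open>u\<close>, \<open>v\<close>, \<open>w\<close>.
  The first occurrence of each letter has the tag \<open>True\<close>, and \<open>i\<close>, \<open>j\<close>, \<open>k\<close> are the tags of the second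
  ones; \<open>False\<close> thus stands for a smoothing that respects orientation.
\<close>

definition triangle where
  "triangle i j k a1 b1 a2 b2 a3 b3 = (\<Sum>u \<in> UNIV. \<Sum>v \<in> UNIV. \<Sum>w \<in> UNIV.
    link u True v True a1 b1 * link u i w True a2 b2 * link v j w k a3 b3)"

definition triangle' where
  "triangle' i j k a1 b1 a2 b2 a3 b3 = (\<Sum>u \<in> UNIV. \<Sum>v \<in> UNIV. \<Sum>w \<in> UNIV.
    link v True u True a1 b1 * link w True u i a2 b2 * link w k v j a3 b3)"

text \<open>
  With \<open>False\<close> as the identity of three strands and \<open>True\<close> as a generator of the Temperley-Lieb algebra,
  these are its relations with loop value \<open>2\<close>. The left side reads \<open>e1\<close>, \<open>e2\<close>, \<open>e1\<close> and the right side
  \<open>e2\<close>, \<open>e1\<close>, \<open>e2\<close>; for instance \<open>e1 e2 e1 = e1\<close> is the sixth equation and \<open>e1 e1 = 2 e1\<close> the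
  seventh. As the tensors depend on six colors only, all cases can be inspected.
\<close>

lemma triangle_eqs:
  "triangle False False False a1 b1 a2 b2 a3 b3 = triangle' False False False a1 b1 a2 b2 a3 b3"
  "triangle False True True a1 b1 a2 b2 a3 b3 = triangle' False True True a1 b1 a2 b2 a3 b3"
  "triangle True True False a1 b1 a2 b2 a3 b3 = triangle' True True False a1 b1 a2 b2 a3 b3"
  "triangle False False True a1 b1 a2 b2 a3 b3 = triangle' False True False a1 b1 a2 b2 a3 b3"
  "triangle True False False a1 b1 a2 b2 a3 b3 = triangle' False True False a1 b1 a2 b2 a3 b3"
  "triangle True True True a1 b1 a2 b2 a3 b3 = triangle' False True False a1 b1 a2 b2 a3 b3"
  "triangle True False True a1 b1 a2 b2 a3 b3 = 2 * triangle' False True False a1 b1 a2 b2 a3 b3"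
  "triangle' False False True a1 b1 a2 b2 a3 b3 = triangle False True False a1 b1 a2 b2 a3 b3"
  "triangle' True False False a1 b1 a2 b2 a3 b3 = triangle False True False a1 b1 a2 b2 a3 b3"
  "triangle' True True True a1 b1 a2 b2 a3 b3 = triangle False True False a1 b1 a2 b2 a3 b3"
  "triangle' True False True a1 b1 a2 b2 a3 b3 = 2 * triangle False True False a1 b1 a2 b2 a3 b3"
  unfolding triangle_def triangle'_def
  by (cases a1; cases b1; cases a2; cases b2; cases a3; cases b3;
      simp add: sum_color_pairs link_def pass_def)+

definition support :: "'l passage option list \<Rightarrow> 'l set" where
  "support u = letters (components u)"

lemma in_support: "A \<in> support u \<longleftrightarrow> (\<exists>i. Some (A, i) \<in> set u)"
proof -
  have "A \<in> support u \<longleftrightarrow> (\<exists>i. (A, i) \<in> set (concat (components u)))"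
    unfolding support_def letters_def by force
  then show ?thesis unfolding set_concat_components .
qed

lemma support_simps [simp]:
  "support [] = {}"
  "support (Some x # u) = insert (fst x) (support u)"
  "support (None # u) = support u"
  "support (u @ v) = support u \<union> support v"
  by (auto simp: in_support) (metis prod.collapse)

lemma colorings_components: "colorings (components u) = (\<Sum>f \<in> support u \<rightarrow>\<^sub>E UNIV. trace f u)"
  by (simp add: colorings_def support_def trace_eq_closures_phrase)

lemma colorings_kink:
  assumes "A \<notin> support (x @ y)"
  shows "colorings (components (x @ [Some (A, i), Some (A, j)] @ y))
    = (if i = j then 1 else 2) * colorings (components (x @ y))"
proof -
  have local: "(\<Sum>v \<in> UNIV. link v i v j a b) = (if i = j then 1 else 2) * of_bool (a = b)" for a b
    by (cases a; cases b; cases i; cases j) (simp_all add: sum_color_pairs link_def pass_def)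
  have "(\<Sum>v \<in> UNIV. trace (f(A := v)) (x @ [Some (A, i), Some (A, j)] @ y))
    = (if i = j then 1 else 2) * trace f (x @ y)" for f
  proof -
    have "(\<Sum>v \<in> UNIV. trace (f(A := v)) (x @ [Some (A, i), Some (A, j)] @ y @ [] @ [] @ [] @ []))
      = (if i = j then 1 else 2) * (\<Sum>v \<in> {f}. trace v (x @ [] @ y @ [] @ [] @ [] @ []))"
    proof (rule trace_replace[where f = f])
      show "(f(A := v)) B = f B" if "Some (B, k) \<in> set (x @ y @ [] @ [])" for v B k
        using that assms by (auto simp: in_support)
      show "(\<Sum>v \<in> UNIV. sweep (f(A := v)) [Some (A, i), Some (A, j)] r1 q1 *
          sweep (f(A := v)) [] r2 q2 * sweep (f(A := v)) [] r3 q3)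
        = (if i = j then 1 else 2) * (\<Sum>v \<in> {f}.
            sweep v [] r1 q1 * sweep v [] r2 q2 * sweep v [] r3 q3)"
        for r1 q1 r2 q2 r3 q3
        unfolding sweep_pair using local[of "snd r1" "snd q1"]
        by (simp add: prod_eq_iff flip: sum_distrib_left sum_distrib_right)
    qed simp
    then show ?thesis by simp
  qed
  then show ?thesis
    using assms by (simp add: colorings_components sum_PiE_insert flip: sum_distrib_left)
qed

definition bigon where
  "bigon i j a1 b1 a2 b2 = (\<Sum>u \<in> UNIV. \<Sum>v \<in> UNIV. link u True v True a1 b1 * link v i u j a2 b2)"

text \<open>
  Both smoothings against orientation leave two strands that run straight through the two places. The
  other three states reconnect the places crosswise, and one of them has an additional closed circle.
\<close>

lemma bigon_eqs:
  "bigon True True a1 b1 a2 b2 = of_bool (a1 = b1 \<and> a2 = b2)"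
  "bigon False False a1 b1 a2 b2 = 2 * bigon True False a1 b1 a2 b2"
  "bigon False True a1 b1 a2 b2 = bigon True False a1 b1 a2 b2"
  unfolding bigon_def
  by (cases a1; cases b1; cases a2; cases b2; simp add: sum_color_pairs link_def pass_def)+

lemma sum_PiE_insert2:
  assumes "A \<noteq> B" "A \<notin> L" "B \<notin> L"
  shows "(\<Sum>f \<in> insert A (insert B L) \<rightarrow>\<^sub>E UNIV. g f) =
    (\<Sum>f \<in> L \<rightarrow>\<^sub>E UNIV. \<Sum>(u, v) \<in> UNIV. g (f(B := v, A := u)))"
  using assms
  by (simp add: sum_PiE_insert sum_UNIV_prod) (subst sum.swap, rule refl)

lemma colorings_bigon:
  fixes x y z A B
  defines "word \<equiv> \<lambda>i j. x @ [Some (A, True), Some (B, True)] @ y @ [Some (B, i), Some (A, j)] @ z"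
  assumes AB: "A \<noteq> B" "A \<notin> support (x @ y @ z)" "B \<notin> support (x @ y @ z)"
  shows "colorings (components (word True True)) = colorings (components (x @ y @ z))"
    and "colorings (components (word False False)) = 2 * colorings (components (word True False))"
    and "colorings (components (word False True)) = colorings (components (word True False))"
proof -
  \<comment> \<open>the extension of a coloring of the other letters by the colors of \<open>A\<close> and \<open>B\<close>\<close>
  define c where "c f = (\<lambda>(u, v). f(B := v, A := u))" for f :: "'a \<Rightarrow> bool \<times> bool" and u v
  have colorings: "colorings (components (word i j))
    = (\<Sum>f \<in> support (x @ y @ z) \<rightarrow>\<^sub>E UNIV. \<Sum>p \<in> UNIV. trace (c f p) (word i j))" for i j
  proof -
    have "support (word i j) = insert A (insert B (support (x @ y @ z)))"
      by (auto simp: word_def)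
    then show ?thesis
      unfolding colorings_components c_def case_prod_beta
      using sum_PiE_insert2[OF AB] by (simp add: case_prod_beta)
  qed
  have agree: "c f p D = f D" if "Some (D, k) \<in> set (x @ y @ z @ [])" for f p D k
    using that AB by (cases p) (auto simp: in_support c_def)
  have local: "(\<Sum>p \<in> UNIV. sweep (c f p) [Some (A, True), Some (B, True)] r1 q1 *
      sweep (c f p) [Some (B, i), Some (A, j)] r2 q2 * sweep (c f p) [] r3 q3)
    = of_bool (fst r1 = fst q1 \<and> fst r2 = fst q2 \<and> r3 = q3) * bigon i j (snd r1) (snd q1) (snd r2)
        (snd q2)"
    for f i j r1 q1 r2 q2 r3 q3
    unfolding sweep_pair bigon_def sum_UNIV_prod c_def using AB by simp
  show "colorings (components (word True True)) = colorings (components (x @ y @ z))"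
    unfolding colorings unfolding colorings_components
  proof (rule sum.cong[OF refl])
    fix f :: "'a \<Rightarrow> bool \<times> bool"
    have "(\<Sum>p \<in> UNIV. trace (c f p) (x @ [Some (A, True), Some (B, True)] @ y @ [Some (B, True),
        Some (A, True)] @ z @ [] @ []))
      = 1 * (\<Sum>g \<in> {f}. trace g (x @ [] @ y @ [] @ z @ [] @ []))"
      by (rule trace_replace[where f = f], rule agree, assumption, simp)
        (unfold local bigon_eqs, auto simp: prod_eq_iff)
    then show "(\<Sum>p \<in> UNIV. trace (c f p) (word True True)) = trace f (x @ y @ z)"
      by (simp add: word_def)
  qed
  have replace: "colorings (components (word i j)) = n * colorings (components (word i' j'))"
    if "\<And>a1 b1 a2 b2. bigon i j a1 b1 a2 b2 = n * bigon i' j' a1 b1 a2 b2" for i j i' j' n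
    unfolding colorings
  proof (subst sum_distrib_left, rule sum.cong[OF refl])
    fix f :: "'a \<Rightarrow> bool \<times> bool"
    have "(\<Sum>p \<in> UNIV. trace (c f p) (x @ [Some (A, True), Some (B, True)] @ y @ [Some (B, i),
        Some (A, j)] @ z @ [] @ []))
      = n * (\<Sum>p \<in> UNIV. trace (c f p) (x @ [Some (A, True), Some (B, True)] @ y @ [Some
          (B, i'), Some (A, j')] @ z @ [] @ []))"
      by (rule trace_replace[where f = f], (rule agree, assumption)+)
        (unfold local that, simp)
    then show "(\<Sum>p \<in> UNIV. trace (c f p) (word i j)) = n * (\<Sum>p \<in> UNIV. trace (c f p) (word i' j'))"
      by (simp add: word_def)
  qed
  show "colorings (components (word False False)) = 2 * colorings (components (word True False))"
    by (rule replace) (rule bigon_eqs)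
  show "colorings (components (word False True)) = colorings (components (word True False))"
    using replace[of False True 1 True False] by (simp add: bigon_eqs)
qed

lemma sum_PiE_insert3:
  fixes g :: "('a \<Rightarrow> 'b) \<Rightarrow> nat"
  assumes "A \<noteq> B" "A \<noteq> C" "B \<noteq> C" "A \<notin> L" "B \<notin> L" "C \<notin> L"
  shows "(\<Sum>f \<in> insert A (insert B (insert C L)) \<rightarrow>\<^sub>E UNIV. g f) =
    (\<Sum>f \<in> L \<rightarrow>\<^sub>E UNIV. \<Sum>(u, v, w) \<in> UNIV. g (f(C := w, B := v, A := u)))"
proof -
  have "(\<Sum>f \<in> insert A (insert B (insert C L)) \<rightarrow>\<^sub>E UNIV. g f)
    = (\<Sum>f \<in> L \<rightarrow>\<^sub>E UNIV. \<Sum>w \<in> UNIV. \<Sum>v \<in> UNIV. \<Sum>u \<in> UNIV. g (f(C := w, B := v, A := u)))"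
    using assms by (simp add: sum_PiE_insert)
  also have "\<dots> = (\<Sum>f \<in> L \<rightarrow>\<^sub>E UNIV. \<Sum>u \<in> UNIV. \<Sum>v \<in> UNIV. \<Sum>w \<in> UNIV. g (f(C := w, B := v, A := u)))"
  proof (rule sum.cong[OF refl])
    fix f
    have "(\<Sum>w \<in> UNIV. \<Sum>v \<in> UNIV. \<Sum>u \<in> UNIV. h u v w) = (\<Sum>u \<in> UNIV. \<Sum>v \<in> UNIV. \<Sum>w \<in> UNIV. h u v w)"
      for h :: "'b \<Rightarrow> 'b \<Rightarrow> 'b \<Rightarrow> nat"
    proof -
      have "(\<Sum>w \<in> UNIV. \<Sum>v \<in> UNIV. \<Sum>u \<in> UNIV. h u v w) = (\<Sum>w \<in> UNIV. \<Sum>u \<in> UNIV. \<Sum>v \<in> UNIV. h u v w)"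
        by (intro sum.cong refl sum.swap)
      also have "\<dots> = (\<Sum>u \<in> UNIV. \<Sum>w \<in> UNIV. \<Sum>v \<in> UNIV. h u v w)"
        by (rule sum.swap)
      also have "\<dots> = (\<Sum>u \<in> UNIV. \<Sum>v \<in> UNIV. \<Sum>w \<in> UNIV. h u v w)"
        by (intro sum.cong refl sum.swap)
      finally show ?thesis .
    qed
    then show "(\<Sum>w \<in> UNIV. \<Sum>v \<in> UNIV. \<Sum>u \<in> UNIV. g (f(C := w, B := v, A := u)))
      = (\<Sum>u \<in> UNIV. \<Sum>v \<in> UNIV. \<Sum>w \<in> UNIV. g (f(C := w, B := v, A := u)))" .
  qed
  finally show ?thesis
    by (simp add: sum_UNIV_prod)
qed

lemma colorings_triangle:
  fixes x y z t A B C
  defines "left \<equiv> \<lambda>i j k. x @ [Some (A, True), Some (B, True)] @ y @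
      [Some (A, i), Some (C, True)] @ z @ [Some (B, j), Some (C, k)] @ t"
    and "right \<equiv> \<lambda>i j k. x @ [Some (B, True), Some (A, True)] @ y @
      [Some (C, True), Some (A, i)] @ z @ [Some (C, k), Some (B, j)] @ t"
  assumes ABC: "A \<noteq> B" "A \<noteq> C" "B \<noteq> C" "A \<notin> support (x @ y @ z @ t)"
    "B \<notin> support (x @ y @ z @ t)" "C \<notin> support (x @ y @ z @ t)"
  shows "(\<And>a1 b1 a2 b2 a3 b3. triangle i j k a1 b1 a2 b2 a3 b3
      = n * triangle' i' j' k' a1 b1 a2 b2 a3 b3) \<Longrightarrow>
      colorings (components (left i j k)) = n * colorings (components (right i' j' k'))"
    and "(\<And>a1 b1 a2 b2 a3 b3. triangle' i' j' k' a1 b1 a2 b2 a3 b3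
        = n * triangle i j k a1 b1 a2 b2 a3 b3) \<Longrightarrow>
      colorings (components (right i' j' k')) = n * colorings (components (left i j k))"
proof -
  \<comment> \<open>the extension of a coloring of the other letters by the colors of \<open>A\<close>, \<open>B\<close> and \<open>C\<close>\<close>
  define c where "c f = (\<lambda>(u, v, w). f(C := w, B := v, A := u))" for f :: "'a \<Rightarrow> bool \<times> bool" and u v w
  have colorings: "colorings (components m)
      = (\<Sum>f \<in> support (x @ y @ z @ t) \<rightarrow>\<^sub>E UNIV. \<Sum>p \<in> UNIV. trace (c f p) m)"
    if "support m = insert A (insert B (insert C (support (x @ y @ z @ t))))" for m
    unfolding colorings_components c_def case_prod_beta that
    using sum_PiE_insert3[OF ABC] by (simp add: case_prod_beta)
  have supp: "support (left i j k) = insert A (insert B (insert C (support (x @ y @ z @ t))))"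
    "support (right i j k) = insert A (insert B (insert C (support (x @ y @ z @ t))))" for i j k
    by (auto simp: left_def right_def)
  have agree: "c f p D = f D" if "Some (D, k) \<in> set (x @ y @ z @ t)" for f p D k
    using that ABC by (cases p) (auto simp: in_support c_def)
  have local: "(\<Sum>p \<in> UNIV. sweep (c f p) [Some (A, True), Some (B, True)] r1 q1 *
      sweep (c f p) [Some (A, i), Some (C, True)] r2 q2 * sweep (c f p) [Some (B, j), Some
          (C, k)] r3 q3)
    = of_bool (fst r1 = fst q1 \<and> fst r2 = fst q2 \<and> fst r3 = fst q3) *
      triangle i j k (snd r1) (snd q1) (snd r2) (snd q2) (snd r3) (snd q3)"
    for f i j k r1 q1 r2 q2 r3 q3
    unfolding sweep_pair triangle_def sum_UNIV_prod c_def using ABC(1-3) by simp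
  have local': "(\<Sum>p \<in> UNIV. sweep (c f p) [Some (B, True), Some (A, True)] r1 q1 *
      sweep (c f p) [Some (C, True), Some (A, i)] r2 q2 * sweep (c f p) [Some (C, k), Some
          (B, j)] r3 q3)
    = of_bool (fst r1 = fst q1 \<and> fst r2 = fst q2 \<and> fst r3 = fst q3) *
      triangle' i j k (snd r1) (snd q1) (snd r2) (snd q2) (snd r3) (snd q3)"
    for f i j k r1 q1 r2 q2 r3 q3
    unfolding sweep_pair triangle'_def sum_UNIV_prod c_def using ABC(1-3) by simp
  show "colorings (components (left i j k)) = n * colorings (components (right i' j' k'))"
    if "\<And>a1 b1 a2 b2 a3 b3. triangle i j k a1 b1 a2 b2 a3 b3
        = n * triangle' i' j' k' a1 b1 a2 b2 a3 b3"
    unfolding colorings[OF supp(1)] colorings[OF supp(2)]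
    unfolding left_def right_def
    by (subst sum_distrib_left, rule sum.cong[OF refl], rule trace_replace, (rule agree, assumption)+)
      (unfold local local' that, simp)
  show "colorings (components (right i' j' k')) = n * colorings (components (left i j k))"
    if "\<And>a1 b1 a2 b2 a3 b3. triangle' i' j' k' a1 b1 a2 b2 a3 b3
        = n * triangle i j k a1 b1 a2 b2 a3 b3"
    unfolding colorings[OF supp(1)] colorings[OF supp(2)]
    unfolding left_def right_def
    by (subst sum_distrib_left, rule sum.cong[OF refl], rule trace_replace, (rule agree, assumption)+)
      (unfold local local' that, simp)
qed

section \<open>Circle counts before and after a move\<close>

abbreviation forget :: "'l passage option list \<Rightarrow> 'l option list" where
  "forget \<equiv> map (map_option fst)"

lemma support_eq: "A \<in> support u \<longleftrightarrow> Some A \<in> set (forget u)"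
  by (induction u rule: components.induct) auto

text \<open>
  The counterpart of \<open>encodes\<close> for words with separators.
\<close>

definition orients :: "('l \<Rightarrow> int) \<Rightarrow> ('l \<Rightarrow> int) \<Rightarrow> 'l passage option list \<Rightarrow> bool" where
  "orients s p u \<longleftrightarrow> (\<forall>A \<in> support u. count_list (forget u) (Some A) = 2 \<and>
     p A \<in> {1, -1} \<and> s A \<in> {1, -1} \<and> (odd (count_list u (Some (A, True))) \<longleftrightarrow> s A = p A))"

text \<open>
  The number of components of a state does not depend on the alphabet; the empty one is a placeholder.
\<close>

definition circles :: "('l \<Rightarrow> int) \<Rightarrow> 'l option list \<Rightarrow> ('l \<Rightarrow> int) \<Rightarrow> nat" where
  "circles p u s = state_components \<lparr>alphabet = {}, proj = p, phrase = components u\<rparr> s"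

lemma state_components_eq_circles:
  "state_components \<lparr>alphabet = X, proj = p, phrase = components u\<rparr> s = circles p u s"
  by (simp add: circles_def state_components_def)

lemma orients_circles:
  assumes "orients s p u"
  shows "colorings (components u) = 2 ^ circles p (forget u) s" "circles p (forget u) s \<ge> 1"
proof -
  have eq: "components (forget u) = map (map fst) (components u)"
    by (rule components_map)
  have letters: "set (concat (components (forget u))) = support u"
    by (intro set_eqI) (simp only: set_concat_components support_eq)
  have "encodes s p (components (forget u)) (components u)"
    using assms unfolding encodes_def orients_def letters eq[symmetric] count_concat_components
    by blast
  then show "colorings (components u) = 2 ^ circles p (forget u) s" "circles p (forget u) s \<ge> 1"
    unfolding circles_def
    by (intro state_components_colorings; simp)+
qed

text \<open>
  The last occurrence of a letter gets the prescribed tag and the earlier ones get \<open>False\<close>, so that the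
  tag \<open>True\<close> occurs an odd number of times just if it was prescribed.
\<close>

fun orient :: "('l \<Rightarrow> bool) \<Rightarrow> 'l option list \<Rightarrow> 'l passage option list" where
  "orient d [] = []"
| "orient d (None # u) = None # orient d u"
| "orient d (Some A # u) = Some (A, d A \<and> Some A \<notin> set u) # orient d u"

lemma forget_orient: "forget (orient d u) = u"
  by (induction d u rule: orient.induct) auto

lemma support_orient: "A \<in> support (orient d u) \<longleftrightarrow> Some A \<in> set u"
  by (simp only: support_eq forget_orient)

lemma count_orient: "count_list (orient d u) (Some (A, True)) = of_bool (d A \<and> Some A \<in> set u)"
  by (induction d u rule: orient.induct) auto

definition signed_word :: "'l set \<Rightarrow> ('l \<Rightarrow> int) \<Rightarrow> 'l option list \<Rightarrow> bool" where
  "signed_word X p u \<longleftrightarrow> finite X \<and> (\<forall>A. Some A \<in> set u \<longleftrightarrow> A \<in> X) \<and>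
     (\<forall>A \<in> X. count_list u (Some A) = 2 \<and> p A \<in> {1, -1})"

lemma ex_orientation:
  assumes "signed_word X p u" "s \<in> X \<rightarrow>\<^sub>E {-1, 1}"
  shows "\<exists>v. forget v = u \<and> orients s p v"
proof (intro exI conjI)
  let ?v = "orient (\<lambda>A. s A = p A) u"
  show "forget ?v = u" by (rule forget_orient)
  show "orients s p ?v"
    using assms unfolding orients_def forget_orient count_orient
    by (auto simp: signed_word_def PiE_iff support_orient)
qed

lemma split_forget_append:
  assumes "forget v = x @ y"
  obtains x' y' where "v = x' @ y'" "forget x' = x" "forget y' = y"
  using assms by (auto simp: map_eq_append_conv)

lemma circles_eq_mult:
  assumes "orients s p u" "orients s' p' v" "colorings (components u) = 2 * colorings (components v)"
  shows "circles p (forget u) s = Suc (circles p' (forget v) s')"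
proof -
  have "(2::nat) ^ circles p (forget u) s = 2 ^ Suc (circles p' (forget v) s')"
    using assms(3) orients_circles(1)[OF assms(1)] orients_circles(1)[OF assms(2)] by simp
  then show ?thesis by (simp only: power_inject_exp)
qed

lemma circles_eq:
  assumes "orients s p u" "orients s' p' v" "colorings (components u) = colorings (components v)"
  shows "circles p (forget u) s = circles p' (forget v) s'"
proof -
  have "(2::nat) ^ circles p (forget u) s = 2 ^ circles p' (forget v) s'"
    using assms(3) orients_circles(1)[OF assms(1)] orients_circles(1)[OF assms(2)] by simp
  then show ?thesis by simp
qed

lemma count_passages_zero:
  "A \<notin> support u \<Longrightarrow> count_list u (Some (A, i)) = 0 \<and> count_list (forget u) (Some A) = 0"
  unfolding count_list_0_iff support_eq[symmetric] by (auto simp: in_support)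

text \<open>
  An encoding of the phrase without \<open>A\<close> extends to the phrase with \<open>A\<close>, for both markers of \<open>A\<close>, by two
  new passages. So all phrases and states that a move relates can be compared through encodings that
  agree outside the move. The same is done for the other two moves below.
\<close>

lemma circles_kink:
  assumes xy: "signed_word Y p (x @ y)" and A: "A \<notin> Y" "p A \<in> {1, -1}" and s: "s \<in> Y \<rightarrow>\<^sub>E {-1, 1}"
  defines "u \<equiv> x @ [Some A, Some A] @ y"
  shows "circles p u (s(A := p A)) = Suc (circles p (x @ y) s)"
    and "circles p u (s(A := - p A)) = circles p (x @ y) s"
    and "circles p (x @ y) s \<ge> 1"
proof -
  obtain v where v: "forget v = x @ y" "orients s p v"
    using ex_orientation[OF xy s] by blast
  obtain x' y' where v': "v = x' @ y'" and xy': "forget x' = x" "forget y' = y"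
    using split_forget_append[OF v(1)] .
  have notin: "A \<notin> support (x' @ y')"
    using xy A v(1) unfolding signed_word_def support_eq v'[symmetric] by metis
  define w where "w i = x' @ [Some (A, True), Some (A, i)] @ y'" for i
  have forget: "forget (w i) = u" for i
    by (simp add: w_def u_def xy')
  have zero: "count_list x' (Some (A, i)) = 0" "count_list y' (Some (A, i)) = 0"
    "count_list (forget x') (Some A) = 0" "count_list (forget y') (Some A) = 0" for i
    using notin count_passages_zero[of A x'] count_passages_zero[of A y'] by auto
  have orients: "orients (s(A := e)) p (w i)" if "e \<in> {1, -1}" "i \<longleftrightarrow> e \<noteq> p A" for e i
    using v(2) notin zero that A(2) unfolding orients_def v' w_def by auto
  have colorings: "colorings (components (w i)) = (if i then 1 else 2) * colorings (components v)"
      for i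
    using colorings_kink[OF notin, of True i] by (simp add: w_def v')
  show "circles p u (s(A := p A)) = Suc (circles p (x @ y) s)"
    by (rule circles_eq_mult[OF orients[of "p A" False] v(2), unfolded forget v(1)])
      (use A(2) colorings[of False] in auto)
  show "circles p u (s(A := - p A)) = circles p (x @ y) s"
    by (rule circles_eq[OF orients[of "- p A" True] v(2), unfolded forget v(1)])
      (use A(2) colorings[of True] in auto)
  show "circles p (x @ y) s \<ge> 1"
    using orients_circles(2)[OF v(2)] by (simp only: v(1))
qed

lemma circles_bigon:
  assumes xyz: "signed_word Y p (x @ y @ z)" and s: "s \<in> Y \<rightarrow>\<^sub>E {-1, 1}"
    and AB: "A \<noteq> B" "A \<notin> Y" "B \<notin> Y" "p A \<in> {1, -1}" "p B \<in> {1, -1}"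
  defines "u \<equiv> x @ [Some A, Some B] @ y @ [Some B, Some A] @ z"
  defines "c \<equiv> \<lambda>a b. circles p u (s(B := b, A := a))"
  shows "c (- p A) (- p B) = circles p (x @ y @ z) s"
    and "c (p A) (p B) = Suc (c (p A) (- p B))"
    and "c (- p A) (p B) = c (p A) (- p B)"
    and "c (p A) (- p B) \<ge> 1"
proof -
  obtain v where v: "forget v = x @ y @ z" "orients s p v"
    using ex_orientation[OF xyz s] by blast
  obtain x' y' z' where v': "v = x' @ y' @ z'" and xyz': "forget x' = x" "forget y' = y"
      "forget z' = z"
    using v(1) by (metis split_forget_append)
  have notin: "A \<notin> support (x' @ y' @ z')" "B \<notin> support (x' @ y' @ z')"
    using xyz AB v(1) unfolding signed_word_def support_eq v'[symmetric] by metis+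
  define w where "w i j = x' @ [Some (A, True), Some (B, True)] @ y' @ [Some (B, i), Some (A,
      j)] @ z'"
    for i j
  have forget: "forget (w i j) = u" for i j
    by (simp add: w_def u_def xyz')
  have zero: "count_list m (Some (D, i)) = 0" "count_list (forget m) (Some D) = 0"
    if "D \<in> {A, B}" "m \<in> {x', y', z'}" for D m i
    using notin that count_passages_zero[of D m] by auto
  have orients: "orients (s(B := b, A := a)) p (w i j)"
    if "a \<in> {1, -1}" "b \<in> {1, -1}" "i \<longleftrightarrow> b \<noteq> p B" "j \<longleftrightarrow> a \<noteq> p A" for a b i j
    using v(2) notin zero that AB unfolding orients_def v' w_def by auto
  note colorings = colorings_bigon[OF AB(1) notin, folded w_def]
  show "c (- p A) (- p B) = circles p (x @ y @ z) s"
    unfolding c_def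
    by (rule circles_eq[OF orients[of _ _ True True] v(2), unfolded forget v(1)])
      (use AB colorings in \<open>auto simp: v'\<close>)
  show "c (p A) (p B) = Suc (c (p A) (- p B))"
    unfolding c_def
    by (rule circles_eq_mult[OF orients[of _ _ False False] orients[of _ _ True False],
        unfolded forget])
      (use AB colorings in auto)
  show "c (- p A) (p B) = c (p A) (- p B)"
    unfolding c_def
    by (rule circles_eq[OF orients[of _ _ False True] orients[of _ _ True False], unfolded forget])
      (use AB colorings in auto)
  show "c (p A) (- p B) \<ge> 1"
    unfolding c_def by (rule orients_circles(2)[OF orients[of _ _ True False], unfolded forget])
      (use AB in auto)
qed

lemma circles_triangle:
  assumes xyzt: "signed_word Y p (x @ y @ z @ t)" and s: "s \<in> Y \<rightarrow>\<^sub>E {-1, 1}"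
    and ABC: "A \<noteq> B" "A \<noteq> C" "B \<noteq> C" "A \<notin> Y" "B \<notin> Y" "C \<notin> Y"
      "p A = e" "p B = e" "p C = e" "e \<in> {1, -1}"
  defines "u \<equiv> x @ [Some A, Some B] @ y @ [Some A, Some C] @ z @ [Some B, Some C] @ t"
    and "u' \<equiv> x @ [Some B, Some A] @ y @ [Some C, Some A] @ z @ [Some C, Some B] @ t"
  defines "l \<equiv> \<lambda>a b c. circles p u (s(C := c, B := b, A := a))"
    and "r \<equiv> \<lambda>a b c. circles p u' (s(C := c, B := b, A := a))"
  shows "l e e e = r e e e" "l e (-e) (-e) = r e (-e) (-e)" "l (-e) (-e) e = r (-e) (-e) e"
    "l e e (-e) = r e (-e) e" "l (-e) e e = r e (-e) e" "l (-e) (-e) (-e) = r e (-e) e"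
    "l (-e) e (-e) = Suc (r e (-e) e)"
    "r e e (-e) = l e (-e) e" "r (-e) e e = l e (-e) e" "r (-e) (-e) (-e) = l e (-e) e"
    "r (-e) e (-e) = Suc (l e (-e) e)"
    "l e (-e) e \<ge> 1" "r e (-e) e \<ge> 1"
proof -
  obtain v where v: "forget v = x @ y @ z @ t" "orients s p v"
    using ex_orientation[OF xyzt s] by blast
  obtain x' y' z' t' where v': "v = x' @ y' @ z' @ t'"
    and xyzt': "forget x' = x" "forget y' = y" "forget z' = z" "forget t' = t"
    using v(1) by (metis split_forget_append)
  have notin: "A \<notin> support (x' @ y' @ z' @ t')" "B \<notin> support (x' @ y' @ z' @ t')"
    "C \<notin> support (x' @ y' @ z' @ t')"
    using xyzt ABC v(1) unfolding signed_word_def support_eq v'[symmetric] by metis+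
  define w where "w i j k = x' @ [Some (A, True), Some (B, True)] @ y' @
    [Some (A, i), Some (C, True)] @ z' @ [Some (B, j), Some (C, k)] @ t'" for i j k
  define w' where "w' i j k = x' @ [Some (B, True), Some (A, True)] @ y' @
    [Some (C, True), Some (A, i)] @ z' @ [Some (C, k), Some (B, j)] @ t'" for i j k
  have forget: "forget (w i j k) = u" "forget (w' i j k) = u'" for i j k
    by (simp_all add: w_def w'_def u_def u'_def xyzt')
  have zero: "count_list m (Some (D, i)) = 0" "count_list (forget m) (Some D) = 0"
    if "D \<in> {A, B, C}" "m \<in> {x', y', z', t'}" for D m i
    using notin that count_passages_zero[of D m] by auto
  have orients: "orients (s(C := c, B := b, A := a)) p (w i j k)"
      "orients (s(C := c, B := b, A := a)) p (w' i j k)"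
    if abc: "a = (if i then - e else e)" "b = (if j then - e else e)" "c = (if k then - e else e)"
    for a b c i j k
  proof -
    let ?s = "s(C := c, B := b, A := a)"
    have good: "count_list (forget m) (Some D) = 2 \<and> p D \<in> {1, -1} \<and> ?s D \<in> {1, -1} \<and>
        (odd (count_list m (Some (D, True))) \<longleftrightarrow> ?s D = p D)"
      if m: "m \<in> {w i j k, w' i j k}" and D: "D \<in> support m" for m D
    proof (cases "D \<in> {A, B, C}")
      case True
      have "count_list (forget m) (Some D) = 2"
        using True m ABC(1-3) by (auto simp: w_def w'_def zero)
      moreover have "p D \<in> {1, -1}" "?s D \<in> {1, -1}"
          "?s D = p D \<longleftrightarrow> \<not> (if D = A then i else if D = B then j else k)"
        using True ABC abc by auto
      moreover have "odd (count_list m (Some (D, True)))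
          \<longleftrightarrow> \<not> (if D = A then i else if D = B then j else k)"
        using True m ABC(1-3) by (auto simp: w_def w'_def zero split: if_splits)
      ultimately show ?thesis by simp
    next
      case False
      then have "D \<in> support v" using D m by (auto simp: w_def w'_def v')
      moreover have "count_list (forget m) (Some D) = count_list (forget v) (Some D)"
        "count_list m (Some (D, True)) = count_list v (Some (D, True))" "?s D = s D"
        using False m by (auto simp: w_def w'_def v')
      ultimately show ?thesis using v(2) unfolding orients_def by metis
    qed
    show "orients ?s p (w i j k)" "orients ?s p (w' i j k)"
      unfolding orients_def by (intro ballI good; simp)+
  qed
  note colorings = colorings_triangle[OF ABC(1-3) notin, folded w_def w'_def]
  have lr: "l a b c = r a' b' c'"
    if "\<And>a1 b1 a2 b2 a3 b3. triangle i j k a1 b1 a2 b2 a3 b3 = triangle' i' j' k' a1 b1 a2 b2 a3 b3"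
      "a = (if i then - e else e)" "b = (if j then - e else e)" "c = (if k then - e else e)"
      "a' = (if i' then - e else e)" "b' = (if j' then - e else e)" "c' = (if k' then - e else e)"
    for a b c a' b' c' i j k i' j' k'
    unfolding l_def r_def
    using circles_eq[OF orients(1)[of a i b j c k] orients(2)[of a' i' b' j' c' k'], unfolded forget]
      colorings(1)[of i j k 1 i' j' k'] that by simp
  have rl: "r a' b' c' = l a b c"
    if "\<And>a1 b1 a2 b2 a3 b3. triangle' i' j' k' a1 b1 a2 b2 a3 b3 = triangle i j k a1 b1 a2 b2 a3 b3"
      "a = (if i then - e else e)" "b = (if j then - e else e)" "c = (if k then - e else e)"
      "a' = (if i' then - e else e)" "b' = (if j' then - e else e)" "c' = (if k' then - e else e)"
    for a b c a' b' c' i j k i' j' k'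
    using lr[of i j k i' j' k'] that by simp
  show "l e e e = r e e e" by (rule lr, rule triangle_eqs(1)) simp_all
  show "l e (-e) (-e) = r e (-e) (-e)" by (rule lr, rule triangle_eqs(2)) simp_all
  show "l (-e) (-e) e = r (-e) (-e) e" by (rule lr, rule triangle_eqs(3)) simp_all
  show "l e e (-e) = r e (-e) e" by (rule lr, rule triangle_eqs(4)) simp_all
  show "l (-e) e e = r e (-e) e" by (rule lr, rule triangle_eqs(5)) simp_all
  show "l (-e) (-e) (-e) = r e (-e) e" by (rule lr, rule triangle_eqs(6)) simp_all
  show "r e e (-e) = l e (-e) e" by (rule rl, rule triangle_eqs(8)) simp_all
  show "r (-e) e e = l e (-e) e" by (rule rl, rule triangle_eqs(9)) simp_all
  show "r (-e) (-e) (-e) = l e (-e) e" by (rule rl, rule triangle_eqs(10)) simp_all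
  show "l (-e) e (-e) = Suc (r e (-e) e)"
    unfolding l_def r_def
    by (rule circles_eq_mult[OF orients(1)[of _ True _ False _ True] orients(2)[of _ False _ True _
        False],
          unfolded forget])
      (simp_all add: colorings(1)[OF triangle_eqs(7)])
  show "r (-e) e (-e) = Suc (l e (-e) e)"
    unfolding l_def r_def
    by (rule circles_eq_mult[OF orients(2)[of _ True _ False _ True] orients(1)[of _ False _ True _
        False],
          unfolded forget])
      (simp_all add: colorings(2)[OF triangle_eqs(11)])
  show "l e (-e) e \<ge> 1" unfolding l_def
    by (rule orients_circles(2)[OF orients(1)[of _ False _ True _ False], unfolded forget]) simp_all
  show "r e (-e) e \<ge> 1" unfolding r_def
    by (rule orients_circles(2)[OF orients(2)[of _ False _ True _ False], unfolded forget]) simp_all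
qed

section \<open>The state sum under the moves\<close>

definition circle_value :: laurent where
  "circle_value = - t_pow 2 - t_pow (-2)"

definition bracket :: "'l set \<Rightarrow> ('l \<Rightarrow> int) \<Rightarrow> 'l option list \<Rightarrow> laurent" where
  "bracket X p u = (\<Sum>s \<in> X \<rightarrow>\<^sub>E {-1, 1}. t_pow (sum s X) * circle_value ^ (circles p u s - 1))"

lemma t_pow_add: "t_pow (m + n) = t_pow m * t_pow n"
  by (simp add: t_pow_def mult_single)

lemma t_pow_0 [simp]: "t_pow 0 = 1"
  by (simp add: t_pow_def)

lemma t_pow_power: "t_pow k ^ n = t_pow (int n * k)"
  by (induction n) (simp_all add: t_pow_add algebra_simps)

lemma neg_t_pow_eq: "neg_t_pow n = (if even n then 1 else - 1) * t_pow n"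
proof (cases "0 \<le> n")
  case True
  then show ?thesis
    by (auto simp: neg_t_pow_def power_minus[of "t_pow 1"] t_pow_power even_nat_iff)
next
  case False
  then show ?thesis
    by (auto simp: neg_t_pow_def power_minus[of "t_pow (-1)"] t_pow_power even_nat_iff)
qed

lemma neg_t_pow_add: "neg_t_pow (m + n) = neg_t_pow m * neg_t_pow n"
  by (auto simp: neg_t_pow_eq t_pow_add)

lemma state_sign_eq:
  assumes "s \<in> X \<rightarrow>\<^sub>E {-1, 1}" "finite X"
  shows "state_sign \<lparr>alphabet = X, proj = p, phrase = P\<rparr> s = sum s X"
proof -
  have "sum s X = (\<Sum>A \<in> X. of_bool (s A = 1) - of_bool (s A = -1))"
    using assms(1) by (intro sum.cong) (auto simp: PiE_iff)
  also have "\<dots> = int (card {A \<in> X. s A = 1}) - int (card {A \<in> X. s A = -1})"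
    using assms(2) by (simp add: sum_subtractf Int_def)
  finally show ?thesis by (simp add: state_sign_def)
qed

lemma jones1_eq_bracket:
  assumes "finite X"
  shows "jones1 \<lparr>alphabet = X, proj = p, phrase = components u\<rparr>
    = neg_t_pow (- 3 * sum p X) * bracket X p u"
  unfolding jones1_def bracket_def states_def writhe_def circle_value_def[symmetric]
  using assms by (simp add: state_sign_eq state_components_eq_circles cong: sum.cong)

lemma sum_states_insert:
  assumes "A \<notin> Y" "e \<in> {1, -1 :: int}"
  shows "(\<Sum>s \<in> insert A Y \<rightarrow>\<^sub>E {-1, 1}. F s) = (\<Sum>s \<in> Y \<rightarrow>\<^sub>E {-1, 1}. F (s(A := e)) + F (s(A := - e)))"
proof -
  have "{-1, 1} = {e, - e}" using assms(2) by auto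
  moreover have "e \<noteq> - e" using assms(2) by auto
  ultimately show ?thesis
    unfolding sum_PiE_insert[OF assms(1)] by simp
qed

lemma sum_upd_state: "finite Y \<Longrightarrow> A \<notin> Y \<Longrightarrow> sum (s(A := e)) (insert A Y) = e + sum s Y"
  for s :: "'l \<Rightarrow> int"
  by (simp add: sum.insert) (rule sum.cong, auto)

text \<open>
  The marker \<open>p A\<close> splits off a circle and \<open>- p A\<close> does not, and
  \<open>t\<^sup>e (- t\<^sup>2 - t\<^sup>-\<^sup>2) + t\<^sup>-\<^sup>e = - t\<^sup>3\<^sup>e\<close> for \<open>e = p A\<close>. The writhe factor compensates for this.
\<close>

lemma bracket_kink:
  assumes xy: "signed_word Y p (x @ y)" and A: "A \<notin> Y" "p A \<in> {1, -1}"
  shows "bracket (insert A Y) p (x @ [Some A, Some A] @ y) = - t_pow (3 * p A) * bracket Y p (x @ y)"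
proof -
  have fin: "finite Y" using xy by (simp add: signed_word_def)
  have coeff: "t_pow (p A) * circle_value + t_pow (- p A) = - t_pow (3 * p A)"
    using A(2) by (auto simp: circle_value_def algebra_simps simp flip: t_pow_add)
  have "t_pow (sum (s(A := p A)) (insert A Y))
      * circle_value ^ (circles p (x @ [Some A, Some A] @ y) (s(A := p A)) - 1)
      + t_pow (sum (s(A := - p A)) (insert A Y)) * circle_value ^ (circles p
          (x @ [Some A, Some A] @ y) (s(A := - p A)) - 1)
    = - t_pow (3 * p A) * (t_pow (sum s Y) * circle_value ^ (circles p (x @ y) s - 1))"
    if s: "s \<in> Y \<rightarrow>\<^sub>E {-1, 1}" for s
  proof -
    note c = circles_kink[OF xy A s]
    obtain n where n: "circles p (x @ y) s = Suc n" using c(3) by (cases "circles p (x @ y) s") auto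
    show ?thesis
      unfolding c(1,2) n coeff[symmetric] sum_upd_state[OF fin A(1)] t_pow_add
      by (simp add: algebra_simps)
  qed
  then show ?thesis
    unfolding bracket_def sum_states_insert[OF A] sum_distrib_left by (intro sum.cong refl)
qed

text \<open>
  Three of the four states of \<open>A\<close> and \<open>B\<close> reconnect the strands in the same way, one of them with an
  additional circle, and their weights add up to \<open>(- t\<^sup>2 - t\<^sup>-\<^sup>2) + t\<^sup>2 + t\<^sup>-\<^sup>2 = 0\<close>. The fourth one has
  weight \<open>1\<close> and leaves the phrase without \<open>A\<close> and \<open>B\<close>.
\<close>

lemma bracket_bigon:
  assumes xyz: "signed_word Y p (x @ y @ z)"
    and AB: "A \<noteq> B" "A \<notin> Y" "B \<notin> Y" "p A \<in> {1, -1}" "p B = - p A"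
  shows "bracket (insert A (insert B Y)) p (x @ [Some A, Some B] @ y @ [Some B, Some A] @ z)
    = bracket Y p (x @ y @ z)"
proof -
  have fin: "finite Y" using xyz by (simp add: signed_word_def)
  have B: "p B \<in> {1, -1}" and notin: "A \<notin> insert B Y" using AB by auto
  let ?u = "x @ [Some A, Some B] @ y @ [Some B, Some A] @ z"
  let ?F = "\<lambda>s. t_pow (sum s (insert A (insert B Y))) * circle_value ^ (circles p ?u s - 1)"
  have "(?F (s(B := p B, A := p A)) + ?F (s(B := p B, A := - p A)))
      + (?F (s(B := - p B, A := p A)) + ?F (s(B := - p B, A := - p A)))
    = t_pow (sum s Y) * circle_value ^ (circles p (x @ y @ z) s - 1)"
    if s: "s \<in> Y \<rightarrow>\<^sub>E {-1, 1}" for s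
  proof -
    note c = circles_bigon[OF xyz s AB(1-4) B]
    obtain n where n: "circles p ?u (s(B := - p B, A := p A)) = Suc n"
      using c(4) by (cases "circles p ?u (s(B := - p B, A := p A))") auto
    have sum: "sum (s(B := b, A := a)) (insert A (insert B Y)) = a + b + sum s Y" for a b
      unfolding sum_upd_state[OF finite.insertI[OF fin] notin] sum_upd_state[OF fin AB(3)] by simp
    have cancel: "circle_value + t_pow (2 * p A) + t_pow (- 2 * p A) = 0"
      using AB(4) by (auto simp: circle_value_def)
    have "?F (s(B := p B, A := p A)) + ?F (s(B := p B, A := - p A)) + ?F (s(B := - p B, A := p A))
      = (circle_value + t_pow (2 * p A) + t_pow (- 2 * p A)) * (t_pow (sum s Y) * circle_value ^ n)"
      unfolding c(2,3) n sum unfolding AB(5) by (simp add: algebra_simps flip: t_pow_add)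
    then have "?F (s(B := p B, A := p A)) + ?F (s(B := p B, A := - p A))
        + ?F (s(B := - p B, A := p A)) = 0"
      unfolding cancel by simp
    moreover have "?F (s(B := - p B, A := - p A))
        = t_pow (sum s Y) * circle_value ^ (circles p (x @ y @ z) s - 1)"
      unfolding c(1) sum unfolding AB(5) by simp
    ultimately show ?thesis by (simp only: add.assoc[symmetric] add_0_left)
  qed
  then show ?thesis
    unfolding bracket_def sum_states_insert[OF notin AB(4)] sum_states_insert[OF AB(3) B]
    by (intro sum.cong refl)
qed

text \<open>
  Three of the eight states on each side have a counterpart on the other side with the same markers and
  the same number of circles. Four of the remaining five, which look like \<open>e1\<close> on the left (\<open>e2\<close> on the
  right), together have the weight of the fifth state of the other side:
  \<open>2 t\<^sup>e + t\<^sup>-\<^sup>e (- t\<^sup>2 - t\<^sup>-\<^sup>2) + t\<^sup>-\<^sup>3\<^sup>e = t\<^sup>e\<close> for \<open>e = \<plusminus>1\<close>.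
\<close>

lemma bracket_triangle:
  assumes xyzt: "signed_word Y p (x @ y @ z @ t)"
    and ABC: "A \<noteq> B" "A \<noteq> C" "B \<noteq> C" "A \<notin> Y" "B \<notin> Y" "C \<notin> Y"
      "p A = e" "p B = e" "p C = e" "e \<in> {1, -1}"
  defines "X \<equiv> insert A (insert B (insert C Y))"
  shows "bracket X p (x @ [Some A, Some B] @ y @ [Some A, Some C] @ z @ [Some B, Some C] @ t)
    = bracket X p (x @ [Some B, Some A] @ y @ [Some C, Some A] @ z @ [Some C, Some B] @ t)"
proof -
  have fin: "finite Y" using xyzt by (simp add: signed_word_def)
  let ?u = "x @ [Some A, Some B] @ y @ [Some A, Some C] @ z @ [Some B, Some C] @ t"
  let ?u' = "x @ [Some B, Some A] @ y @ [Some C, Some A] @ z @ [Some C, Some B] @ t"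
  let ?F = "\<lambda>u s. t_pow (sum s X) * circle_value ^ (circles p u s - 1)"
  have notin: "A \<notin> insert B (insert C Y)" "B \<notin> insert C Y" using ABC by auto
  have bracket: "bracket X p u = (\<Sum>s \<in> Y \<rightarrow>\<^sub>E {-1, 1}.
      (?F u (s(C := e, B := e, A := e)) + ?F u (s(C := e, B := e, A := - e))
        + (?F u (s(C := e, B := - e, A := e)) + ?F u (s(C := e, B := - e, A := - e))))
      + (?F u (s(C := - e, B := e, A := e)) + ?F u (s(C := - e, B := e, A := - e))
        + (?F u (s(C := - e, B := - e, A := e)) + ?F u (s(C := - e, B := - e, A := - e)))))" for u
    unfolding bracket_def X_def sum_states_insert[OF notin(1) ABC(10)]
      sum_states_insert[OF notin(2) ABC(10)] sum_states_insert[OF ABC(6,10)] ..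
  have sum: "sum (s(C := c, B := b, A := a)) X = a + b + c + sum s Y" for s and a b c :: int
    unfolding X_def sum_upd_state[OF finite.insertI[OF finite.insertI[OF fin]] notin(1)]
      sum_upd_state[OF finite.insertI[OF fin] notin(2)] sum_upd_state[OF fin ABC(6)] by simp
  have coeff: "t_pow (e + e - e) + t_pow (- e + e + e) + t_pow (- e + e - e) * circle_value
      + t_pow (- e - e - e)
      = t_pow (e - e + e)"
    using ABC(10) by (auto simp: circle_value_def algebra_simps simp flip: t_pow_add)
  show ?thesis
    unfolding bracket
  proof (rule sum.cong[OF refl])
    fix s assume s: "s \<in> Y \<rightarrow>\<^sub>E {-1, 1 :: int}"
    note c = circles_triangle[OF xyzt s ABC]
    let ?l = "circles p ?u (s(C := e, B := - e, A := e))"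
    let ?r = "circles p ?u' (s(C := e, B := - e, A := e))"
    obtain m where m: "?l = Suc m" using c(12) by (cases ?l) auto
    obtain n where n: "?r = Suc n" using c(13) by (cases ?r) auto
    have l: "?F ?u (s(C := - e, B := e, A := e)) + ?F ?u (s(C := e, B := e, A := - e))
        + ?F ?u (s(C := - e, B := e, A := - e)) + ?F ?u (s(C := - e, B := - e, A := - e))
      = ?F ?u' (s(C := e, B := - e, A := e))"
    proof -
      have "?F ?u (s(C := - e, B := e, A := e)) + ?F ?u (s(C := e, B := e, A := - e))
        + ?F ?u (s(C := - e, B := e, A := - e)) + ?F ?u (s(C := - e, B := - e, A := - e))
        = (t_pow (e + e - e) + t_pow (- e + e + e) + t_pow (- e + e - e) * circle_value + t_pow
            (- e - e - e))
          * (t_pow (sum s Y) * circle_value ^ n)"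
        unfolding c(4-7) n sum t_pow_add[of _ "sum s Y"] by (simp add: algebra_simps)
      also have "\<dots> = ?F ?u' (s(C := e, B := - e, A := e))"
        unfolding coeff n sum t_pow_add[of _ "sum s Y"] by (simp add: algebra_simps)
      finally show ?thesis .
    qed
    have r: "?F ?u' (s(C := - e, B := e, A := e)) + ?F ?u' (s(C := e, B := e, A := - e))
        + ?F ?u' (s(C := - e, B := e, A := - e)) + ?F ?u' (s(C := - e, B := - e, A := - e))
      = ?F ?u (s(C := e, B := - e, A := e))"
    proof -
      have "?F ?u' (s(C := - e, B := e, A := e)) + ?F ?u' (s(C := e, B := e, A := - e))
        + ?F ?u' (s(C := - e, B := e, A := - e)) + ?F ?u' (s(C := - e, B := - e, A := - e))
        = (t_pow (e + e - e) + t_pow (- e + e + e) + t_pow (- e + e - e) * circle_value + t_pow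
            (- e - e - e))
          * (t_pow (sum s Y) * circle_value ^ m)"
        unfolding c(8-11) m sum t_pow_add[of _ "sum s Y"] by (simp add: algebra_simps)
      also have "\<dots> = ?F ?u (s(C := e, B := - e, A := e))"
        unfolding coeff m sum t_pow_add[of _ "sum s Y"] by (simp add: algebra_simps)
      finally show ?thesis .
    qed
    have eq: "a1 + a2 + (a3 + a4) + (a5 + a6 + (a7 + a8))
        = b1 + b2 + (b3 + b4) + (b5 + b6 + (b7 + b8))"
      if "a1 = b1" "a7 = b7" "a4 = b4" "a5 + a2 + a6 + a8 = b3" "b5 + b2 + b6 + b8 = a3"
      for a1 a2 a3 a4 a5 a6 a7 a8 b1 b2 b3 b4 b5 b6 b7 b8 :: laurent
      unfolding that(1-3) that(4,5)[symmetric] by (simp add: algebra_simps)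
    show "(?F ?u (s(C := e, B := e, A := e)) + ?F ?u (s(C := e, B := e, A := - e))
        + (?F ?u (s(C := e, B := - e, A := e)) + ?F ?u (s(C := e, B := - e, A := - e))))
      + (?F ?u (s(C := - e, B := e, A := e)) + ?F ?u (s(C := - e, B := e, A := - e))
        + (?F ?u (s(C := - e, B := - e, A := e)) + ?F ?u (s(C := - e, B := - e, A := - e))))
      = (?F ?u' (s(C := e, B := e, A := e)) + ?F ?u' (s(C := e, B := e, A := - e))
        + (?F ?u' (s(C := e, B := - e, A := e)) + ?F ?u' (s(C := e, B := - e, A := - e))))
      + (?F ?u' (s(C := - e, B := e, A := e)) + ?F ?u' (s(C := - e, B := e, A := - e))
        + (?F ?u' (s(C := - e, B := - e, A := e)) + ?F ?u' (s(C := - e, B := - e, A := - e))))"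
      by (rule eq[OF _ _ _ l r]) (simp_all only: c(1-3))
  qed
qed

section \<open>Renaming of letters and homotopy\<close>

abbreviation rename :: "('l \<Rightarrow> 'm) \<Rightarrow> 'l passage option list \<Rightarrow> 'm passage option list" where
  "rename f \<equiv> map (map_option (map_prod f id))"

lemma sweep_rename: "sweep g (rename f u) r q = sweep (g \<circ> f) u r q"
proof (induction u arbitrary: r rule: components.induct)
  case (3 x u)
  then show ?case by (cases x) simp
qed auto

lemma forget_rename: "forget (rename f u) = map (map_option f) (forget u)"
  by (simp add: option.map_comp o_def)

lemma support_rename: "support (rename f u) = f ` support u"
  by (induction u rule: components.induct) auto

lemma colorings_rename:
  assumes "inj_on f (support u)"
  shows "colorings (components (rename f u)) = colorings (components u)"
proof -
  have "trace g (rename f u) = trace (restrict (g \<circ> f) (support u)) u" for g :: "'b \<Rightarrow> bool \<times> bool"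
  proof -
    have "sweep g (rename f u) r q = sweep (restrict (g \<circ> f) (support u)) u r q" for r q
      unfolding sweep_rename by (rule sweep_cong) (auto simp: in_support)
    then show ?thesis by (simp add: trace_def)
  qed
  then show ?thesis
    unfolding colorings_components support_rename using sum_PiE_image[OF assms] by simp
qed

lemma count_rename:
  assumes "\<And>B. B \<in> support u \<Longrightarrow> f B = f A \<Longrightarrow> B = A"
  shows "count_list (rename f u) (Some (f A, i)) = count_list u (Some (A, i))"
  using assms
proof (induction u rule: components.induct)
  case (3 x u)
  have "count_list (rename f u) (Some (f A, i)) = count_list u (Some (A, i))"
    using "3.prems" by (intro "3.IH") simp
  moreover have "map_prod f id x = (f A, i) \<longleftrightarrow> x = (A, i)"
    using "3.prems"[of "fst x"] by (cases x) auto
  ultimately show ?case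
    by (simp only: list.map option.map count_list.simps option.inject)
qed auto

text \<open>
  Renaming turns an encoding into an encoding and colorings into colorings.
\<close>

lemma bracket_rename:
  assumes u: "signed_word X p u" and u': "signed_word (f ` X) p' (map (map_option f) u)"
    and f: "inj_on f X" "\<And>A. A \<in> X \<Longrightarrow> p' (f A) = p A"
  shows "bracket (f ` X) p' (map (map_option f) u) = bracket X p u"
proof -
  let ?F = "\<lambda>s. t_pow (sum s X) * circle_value ^ (circles p u s - 1)"
  have "t_pow (sum g (f ` X)) * circle_value ^ (circles p' (map (map_option f) u) g - 1)
      = ?F (restrict (g \<circ> f) X)"
    if g: "g \<in> f ` X \<rightarrow>\<^sub>E {-1, 1}" for g
  proof -
    let ?s = "restrict (g \<circ> f) X"
    have s: "?s \<in> X \<rightarrow>\<^sub>E {-1, 1}" using g by auto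
    obtain v where v: "forget v = u" "orients ?s p v"
      using ex_orientation[OF u s] by blast
    have supp: "support v = X"
      using u v(1) unfolding signed_word_def by (auto simp: support_eq)
    have v': "forget (rename f v) = map (map_option f) u"
      by (simp only: forget_rename v(1))
    have "orients g p' (rename f v)"
      unfolding orients_def support_rename supp v'
    proof (intro ballI)
      fix B assume "B \<in> f ` X"
      then obtain A where A: "A \<in> X" "B = f A" by blast
      have "count_list (rename f v) (Some (B, True)) = count_list v (Some (A, True))"
        unfolding A(2) by (rule count_rename) (use A f(1) supp in \<open>auto simp: inj_on_def\<close>)
      moreover have "odd (count_list v (Some (A, True))) \<longleftrightarrow> ?s A = p A"
        using v(2) A supp unfolding orients_def by blast
      ultimately have "odd (count_list (rename f v) (Some (B, True))) \<longleftrightarrow> g B = p' B"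
        using A f(2) by simp
      moreover have "count_list (map (map_option f) u) (Some B) = 2" "p' B \<in> {1, -1}"
        using u' \<open>B \<in> f ` X\<close> unfolding signed_word_def by blast+
      moreover have "g B \<in> {1, -1}" using g \<open>B \<in> f ` X\<close> by auto
      ultimately show "count_list (map (map_option f) u) (Some B)
          = 2 \<and> p' B \<in> {1, -1} \<and> g B \<in> {1, -1} \<and>
          (odd (count_list (rename f v) (Some (B, True))) \<longleftrightarrow> g B = p' B)"
        by blast
    qed
    then have "circles p' (map (map_option f) u) g = circles p u ?s"
      using circles_eq[OF _ v(2) colorings_rename[of f v]] f(1) supp v(1) v' by simp
    moreover have "sum g (f ` X) = sum ?s X"
      by (simp add: sum.reindex[OF f(1)])
    ultimately show ?thesis by simp
  qed
  then have "bracket (f ` X) p' (map (map_option f) u)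
      = (\<Sum>g \<in> f ` X \<rightarrow>\<^sub>E {-1, 1}. ?F (restrict (g \<circ> f) X))"
    unfolding bracket_def by (intro sum.cong refl)
  also have "\<dots> = bracket X p u"
    unfolding bracket_def by (rule sum_PiE_image[OF f(1)])
  finally show ?thesis .
qed

lemma ex_components: "P \<noteq> [] \<Longrightarrow> \<exists>u. components u = P"
proof (induction P)
  case (Cons w P)
  have word: "components (map Some w @ None # u) = w # components u" "components (map Some w) = [w]"
      for u
    by (induction w) auto
  show ?case
  proof (cases "P = []")
    case True
    then show ?thesis using word(2) by blast
  next
    case False
    then show ?thesis using Cons word(1) by metis
  qed
qed simp

abbreviation signs :: "('l \<Rightarrow> alpha0) \<Rightarrow> 'l \<Rightarrow> int" where
  "signs q \<equiv> sign0 \<circ> q"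

lemma sign0_cases: "sign0 a \<in> {1, -1}"
  by (cases a) auto

lemma signs_cases: "signs q A \<in> {1, -1}"
  using sign0_cases by simp

lemma sign0_tau0: "sign0 (tau0 a) = - sign0 a"
  by (cases a) auto

lemma nanophrase_signed_word:
  assumes "is_nanophrase \<lparr>alphabet = X, proj = q, phrase = components u\<rparr>"
  shows "signed_word X (signs q) u"
proof -
  have "set (concat (components u)) \<subseteq> X" and fin: "finite X"
    and count: "\<And>A. A \<in> X \<Longrightarrow> count_list u (Some A) = 2"
    using assms by (auto simp: is_nanophrase_def simp flip: count_concat_components)
  then have "Some A \<in> set u \<longleftrightarrow> A \<in> X" for A
    by (metis count_list_0_iff set_concat_components subsetD zero_neq_numeral)
  then show ?thesis
    using fin count sign0_cases unfolding signed_word_def comp_def by blast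
qed

lemma jones_eq_bracket:
  assumes "is_nanophrase \<lparr>alphabet = X, proj = q, phrase = components u\<rparr>"
  shows "jones \<lparr>alphabet = X, proj = q, phrase = components u\<rparr>
    = neg_t_pow (- 3 * sum (signs q) X) * bracket X (signs q) u"
  using assms by (simp add: jones_def jones1_eq_bracket is_nanophrase_def)

lemma jones_isomorphic:
  assumes N: "is_nanophrase N" and N': "is_nanophrase N'" and "isomorphic N N'"
  shows "jones N = jones N'"
proof -
  obtain X q u where Nu: "N = \<lparr>alphabet = X, proj = q, phrase = components u\<rparr>"
    using N ex_components[of "phrase N"] by (cases N) (auto simp: is_nanophrase_def)
  obtain f where f: "bij_betw f X (alphabet N')" "\<And>A. A \<in> X \<Longrightarrow> proj N' (f A) = q A"
    "phrase N' = map (map f) (components u)"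
    using assms(3) by (auto simp: isomorphic_def Nu)
  obtain q' where Nu': "N' = \<lparr>alphabet = f ` X, proj = q', phrase
      = components (map (map_option f) u)\<rparr>"
    using f by (cases N') (auto simp: components_map bij_betw_def)
  have inj: "inj_on f X" and q': "\<And>A. A \<in> X \<Longrightarrow> signs q' (f A) = signs q A"
    using f by (auto simp: bij_betw_def Nu')
  have "sum (signs q') (f ` X) = sum (signs q) X"
    using q' by (simp add: sum.reindex[OF inj])
  moreover have "bracket (f ` X) (signs q') (map (map_option f) u) = bracket X (signs q) u"
    by (rule bracket_rename[OF nanophrase_signed_word nanophrase_signed_word inj q'])
      (use N N' in \<open>simp_all add: Nu Nu'\<close>)
  ultimately show ?thesis
    using N N' unfolding Nu Nu' by (simp add: jones_eq_bracket del: map_map)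
qed

lemma signed_word_delete:
  assumes "signed_word X p u" "\<And>D. D \<notin> L \<Longrightarrow> count_list v (Some D) = count_list u (Some D)"
    and "\<And>D. D \<in> L \<Longrightarrow> Some D \<notin> set v"
  shows "signed_word (X - L) p v"
  using assms unfolding signed_word_def by (metis DiffD1 DiffD2 DiffI count_list_0_iff finite_Diff)

text \<open>
  In the first move \<open>(-t)\<^sup>-\<^sup>3\<^sup>e (- t\<^sup>3\<^sup>e) = 1\<close> for the sign \<open>e\<close> of \<open>A\<close>. In the second one the two
  letters have opposite signs, so that the writhe stays the same; in the third one it is clear that it does.
\<close>

lemma jones_homotopy_move:
  assumes N: "is_nanophrase N" and N': "is_nanophrase N'" and "homotopy_move tau0 S0 N N'"
  shows "jones N = jones N'"
  using assms(3)
proof cases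
  case (H1 X q x A y)
  note nano = N[unfolded H1(1)] N'[unfolded H1(2)]
  note signed = nanophrase_signed_word[OF nano(1)] nanophrase_signed_word[OF nano(2)]
  have X: "X = insert A (X - {A})" and fin: "finite X"
    using signed(1) by (auto simp: signed_word_def)
  have writhe: "sum (signs q) X = signs q A + sum (signs q) (X - {A})"
    using X fin by (metis Diff_iff finite_Diff insertI1 sum.insert)
  have bracket: "bracket X (signs q) (x @ [Some A, Some A] @ y)
      = - t_pow (3 * signs q A) * bracket (X - {A}) (signs q) (x @ y)"
    using bracket_kink[OF signed(2), of A] sign0_cases X by (metis Diff_iff comp_apply insertI1)
  have unit: "neg_t_pow (- 3 * signs q A) * - t_pow (3 * signs q A) = 1"
    using sign0_cases[of "q A"] by (auto simp: neg_t_pow_eq simp flip: t_pow_add)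
  have "jones N = (neg_t_pow (- 3 * signs q A) * - t_pow (3 * signs q A)) *
      (neg_t_pow (- 3 * sum (signs q) (X - {A})) * bracket (X - {A}) (signs q) (x @ y))"
    unfolding H1 jones_eq_bracket[OF nano(1)] writhe bracket
    by (simp only: distrib_left neg_t_pow_add mult_ac)
  then show ?thesis
    unfolding unit unfolding H1 jones_eq_bracket[OF nano(2)] by simp
next
  case (H2 q A B X x y z)
  note nano = N[unfolded H2(1)] N'[unfolded H2(2)]
  note signed = nanophrase_signed_word[OF nano(1)] nanophrase_signed_word[OF nano(2)]
  have AB: "A \<in> X" "B \<in> X" and fin: "finite X"
    using signed(1) by (auto simp: signed_word_def)
  then have X: "X = insert A (insert B (X - {A, B}))" by blast
  have "A \<noteq> B"
  proof
    assume "A = B"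
    then have "count_list (x @ [Some A, Some B] @ y @ [Some B, Some A] @ z) (Some A) \<ge> 4" by simp
    then show False using signed(1) AB by (auto simp: signed_word_def)
  qed
  have pB: "signs q B = - signs q A"
    using H2(3) sign0_tau0[of "q A"] by simp
  have "sum (signs q) X = sum (signs q) (X - {A, B})"
  proof -
    have "sum (signs q) (insert A (insert B (X - {A, B}))) = sum (signs q) (X - {A, B})"
      using fin \<open>A \<noteq> B\<close> pB by simp
    then show ?thesis using X by simp
  qed
  moreover have "bracket X (signs q) (x @ [Some A, Some B] @ y @ [Some B, Some A] @ z)
      = bracket (X - {A, B}) (signs q) (x @ y @ z)"
    using bracket_bigon[OF signed(2) \<open>A \<noteq> B\<close> _ _ signs_cases pB] unfolding X[symmetric] by blast
  ultimately show ?thesis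
    unfolding H2 jones_eq_bracket[OF nano(1)] jones_eq_bracket[OF nano(2)] by simp
next
  case (H3 q A B C X x y z t)
  note nano = N[unfolded H3(1)] N'[unfolded H3(2)]
  note signed = nanophrase_signed_word[OF nano(1)]
  let ?u = "x @ [Some A, Some B] @ y @ [Some A, Some C] @ z @ [Some B, Some C] @ t"
  have in_X: "A \<in> X" "B \<in> X" "C \<in> X"
    using signed by (auto simp: signed_word_def)
  then have count: "count_list ?u (Some A) = 2" "count_list ?u (Some B) = 2"
      "count_list ?u (Some C) = 2"
    using signed unfolding signed_word_def by blast+
  have distinct: "A \<noteq> B" "A \<noteq> C" "B \<noteq> C"
    using count by (auto split: if_splits)
  have signed': "signed_word (X - {A, B, C}) (signs q) (x @ y @ z @ t)"
  proof (rule signed_word_delete[OF signed])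
    show "count_list (x @ y @ z @ t) (Some D) = count_list ?u (Some D)" if "D \<notin> {A, B, C}" for D
      using that by auto
    show "Some D \<notin> set (x @ y @ z @ t)" if "D \<in> {A, B, C}" for D
      using that count distinct by (auto simp: count_list_0_iff)
  qed
  have "signs q B = signs q A" "signs q C = signs q A"
    using H3(3) by (auto simp: S0_def)
  moreover have X: "X = insert A (insert B (insert C (X - {A, B, C})))" using in_X by blast
  ultimately have "bracket X (signs q) ?u
      = bracket X (signs q) (x @ [Some B, Some A] @ y @ [Some C, Some A] @ z @ [Some C, Some B] @ t)"
    using bracket_triangle[OF signed' distinct _ _ _ refl _ _ signs_cases] unfolding X[symmetric]
        by blast
  then show ?thesis
    unfolding H3 jones_eq_bracket[OF nano(1)] jones_eq_bracket[OF nano(2)] by simp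
qed

theorem corollary2:
  fixes P P' :: "('l, alpha0) nanophrase"
  assumes "is_nanophrase P" and "is_nanophrase P'"
    and "homotopic tau0 S0 P P'"
  shows "jones P = jones P'"
proof -
  have step: "jones N = jones N'" if "homotopy_step tau0 S0 N N'"
      for N N' :: "('l, alpha0) nanophrase"
    using that jones_isomorphic jones_homotopy_move unfolding homotopy_step_def by blast
  have "equivclp (homotopy_step tau0 S0) P P'"
    using assms(3) by (simp add: homotopic_def)
  then show ?thesis
    by (induction rule: equivclp_induct) (auto dest: step)
qed

end
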